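(* Let $n,l$ be positive integers. For $1\le i\le n$ let $G'_i=(G'_{i1},\dots,G'_{il})\in k^l[[X_1,\dots,X_n]]$ and let $G'=(G'_{ij})_{1\le i\le n,\,1\le j\le l}$. Assume that for some $(r_1,\dots,r_n)\in\mathbb{R}_+^n$ (all $r_i>0$) each $G'_i$ is convergent in $B(0,r_i)$, and let $M_i=\|G'_i\|_{r_i}>0$, $r=\min_i r_i$ and $M=\max_i M_i$. Then for $u'\in B_0(0,r/M)\subset k^l$ and $w'\in B_0(0,r)\subset k^n$, $$H(u',w')=w'+\sum_{N\ge1}\ \sum_{\vartheta\in\mathcal{T}_N}\mathrm{Val}(\vartheta)(u',w')$$ is the unique solution $h\in B_0(0,r)\subset k^n$ of $$h=w'+G'(h)\cdot u'.$$ Moreover $H$ is analytic in $B_0(0,r/M)\times B_0(0,r)$.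
   Context: $(k,|\cdot|)$ is a field of characteristic zero, complete with respect to a non-trivial ultrametric absolute value ($|x+y|\le\sup(|x|,|y|)$). For any $m$, $k^m$ carries the norm $\|x\|=\sup_i|x_i|$; $B_0(x,\rho)=\{y:\|x-y\|<\rho\}$ and $B(x,\rho)$ is the closed ball of radius $\rho$. A power series $F=\sum_{\alpha\in\mathbb{N}^n}F_\alpha X^\alpha$ with coefficients in $k^m$ converges in $B(0,\rho)$ if $\sum_\alpha\|F_\alpha\|\rho^{|\alpha|}<+\infty$, where $|\alpha|=\sum_i\alpha_i$; it converges in $B_0(0,\rho)$ if it converges in $B(0,\rho')$ for all $0<\rho'<\rho$; and $\|F\|_\rho=\sup_\alpha\|F_\alpha\|\rho^{|\alpha|}$. A convergent series is identified with the function it defines. A function on an open set $U$ is analytic in $U$ if for every $x\in U$ there are $\rho>0$ with $B_0(x,\rho)\subset U$ and a power series converging in $B_0(0,\rho)$ whose sum at $y$ equals the value of the function at $x+y$ for all $y\in B_0(0,\rho)$. $G'(h)\cdot u'\in k^n$ is the vector with $i$-th component $\sum_{j=1}^l G'_{ij}(h)u'_j$. For $t\ge1$ and $v^{(1)},\dots,v^{(t)}\in k^n$, $d^tG'(w)(v^{(1)},\dots,v^{(t)})$ is the $n\times l$ matrix with entries $\sum_{l_1,\dots,l_t=1}^n D_{l_1}\cdots D_{l_t}G'_{ij}(w)\,v^{(1)}_{l_1}\cdots v^{(t)}_{l_t}$, where $D_i$ is the $i$-th partial derivative. Rooted trees: $\mathcal{T}_N$ is the set of rooted trees with $N$ nodes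 in which the subtrees attached to each node are ordered. Thus $\mathcal{T}_1$ consists of the single-node tree, and for $N\ge2$ each $\vartheta\in\mathcal{T}_N$ is uniquely written as $\vartheta=(t,\vartheta^1,\dots,\vartheta^t)$ with $t\ge1$ the number of lines entering the root, $\vartheta^i\in\mathcal{T}_{N_i}$ and $N_1+\dots+N_t=N-1$; all such tuples occur. Definition of $\mathrm{Val}$: if $\vartheta\in\mathcal{T}_1$, $\mathrm{Val}(\vartheta)(u',w')=G'(w')\cdot u'$; otherwise, with $\vartheta=(t,\vartheta^1,\dots,\vartheta^t)$, $$\mathrm{Val}(\vartheta)(u',w')=\frac1{t!}\,d^tG'(w')\left(\mathrm{Val}(\vartheta^1)(u',w'),\dots,\mathrm{Val}(\vartheta^t)(u',w')\right)\cdot u'.$$ *)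

theory Defs
  imports "HOL-Analysis.Analysis"
begin

text \<open>The absolute value does not extend the real one, so \<^class>\<open>real_normed_field\<close> (and with it
  the library constant \<^const>\<open>norm\<close>) is not applicable.
  Nonnegativity and definiteness of \<open>absv\<close> follow from \<open>dist_absv\<close>.\<close>

class complete_ultrametric_field = field_char_0 + complete_space +
  fixes absv :: "'a \<Rightarrow> real"
  assumes dist_absv: "dist x y = absv (x - y)"
    and absv_mult: "absv (x * y) = absv x * absv y"
    and absv_ultrametric: "absv (x + y) \<le> max (absv x) (absv y)"
    and absv_nontrivial: "\<exists>x. x \<noteq> 0 \<and> absv x \<noteq> 1"

text \<open>The library metric on \<open>'k ^ 'm\<close> is the Euclidean combination of the component distances.
  It induces the same (product) topology as the sup-norm, and only its topology is used below
  (for infinite sums); all balls are taken with respect to the sup-norm.\<close>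

definition supnorm :: "'k::complete_ultrametric_field ^ 'm::finite \<Rightarrow> real" where
  "supnorm x = (MAX i. absv (x $ i))"

definition oball :: "'k::complete_ultrametric_field ^ 'm::finite \<Rightarrow> real \<Rightarrow> ('k ^ 'm) set" where
  "oball x \<rho> = {y. supnorm (x - y) < \<rho>}"

text \<open>A power series in variables indexed by \<open>'n\<close> is its family of coefficients, indexed by
  multi-indices \<open>'n \<Rightarrow> nat\<close>.\<close>

type_synonym ('k, 'n, 'm) pseries = "('n \<Rightarrow> nat) \<Rightarrow> 'k ^ 'm"

definition degree_of :: "('n::finite \<Rightarrow> nat) \<Rightarrow> nat" where
  "degree_of \<alpha> = (\<Sum>i\<in>UNIV. \<alpha> i)"

definition converges_cball :: "('k::complete_ultrametric_field, 'n::finite, 'm::finite) pseries \<Rightarrow> real \<Rightarrow> bool" where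
  "converges_cball F \<rho> \<longleftrightarrow> (\<lambda>\<alpha>. supnorm (F \<alpha>) * \<rho> ^ degree_of \<alpha>) summable_on UNIV"

definition converges_oball :: "('k::complete_ultrametric_field, 'n::finite, 'm::finite) pseries \<Rightarrow> real \<Rightarrow> bool" where
  "converges_oball F \<rho> \<longleftrightarrow> (\<forall>\<rho>'. 0 < \<rho>' \<and> \<rho>' < \<rho> \<longrightarrow> converges_cball F \<rho>')"

definition pseries_norm :: "('k::complete_ultrametric_field, 'n::finite, 'm::finite) pseries \<Rightarrow> real \<Rightarrow> real" where
  "pseries_norm F \<rho> = (SUP \<alpha>. supnorm (F \<alpha>) * \<rho> ^ degree_of \<alpha>)"

definition pseries_eval ::
  "('k::complete_ultrametric_field, 'n::finite, 'm::finite) pseries \<Rightarrow> 'k ^ 'n \<Rightarrow> 'k ^ 'm" where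
  "pseries_eval F x = (\<Sum>\<^sub>\<infinity>\<alpha>. (\<Prod>i\<in>UNIV. x $ i ^ \<alpha> i) *s F \<alpha>)"

text \<open>Openness of \<open>U\<close> is implied by the inclusion of a ball around each point.\<close>

definition ultra_analytic_on ::
  "('k::complete_ultrametric_field ^ 'n::finite \<Rightarrow> 'k ^ 'm::finite) \<Rightarrow> ('k ^ 'n) set \<Rightarrow> bool" where
  "ultra_analytic_on f U \<longleftrightarrow>
     (\<forall>x\<in>U. \<exists>\<rho>>0. oball x \<rho> \<subseteq> U \<and>
        (\<exists>F. converges_oball F \<rho> \<and> (\<forall>y\<in>oball 0 \<rho>. f (x + y) = pseries_eval F y)))"

definition partial_deriv ::
  "'n::finite \<Rightarrow> ('k::complete_ultrametric_field ^ 'n \<Rightarrow> 'k) \<Rightarrow> 'k ^ 'n \<Rightarrow> 'k" where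
  "partial_deriv i f w = Lim (at 0) (\<lambda>s. (f (w + axis i s) - f w) / s)"

text \<open>The order \<open>t\<close> of the differential is the length of the list \<open>vs\<close> of its vector arguments;
  the summation index \<open>ls\<close> runs over all tuples \<open>(l\<^sub>1, \<dots>, l\<^sub>t)\<close>, and
  \<open>foldr partial_deriv ls\<close> is \<open>D\<^bsub>l\<^sub>1\<^esub> \<dots> D\<^bsub>l\<^sub>t\<^esub>\<close>.\<close>

definition matrix_differential ::
  "('k::complete_ultrametric_field ^ 'n::finite \<Rightarrow> 'k ^ 'l ^ 'n) \<Rightarrow> 'k ^ 'n \<Rightarrow> ('k ^ 'n) list
     \<Rightarrow> 'k ^ 'l ^ 'n" where
  "matrix_differential A w vs =
     (\<chi> i j. \<Sum>ls | length ls = length vs.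
        foldr partial_deriv ls (\<lambda>x. A x $ i $ j) w * (\<Prod>s<length vs. (vs ! s) $ (ls ! s)))"

datatype otree = Node "otree list"

primrec node_count :: "otree \<Rightarrow> nat" where
  "node_count (Node ts) = Suc (sum_list (map node_count ts))"

definition trees :: "nat \<Rightarrow> otree set" where
  "trees N = {\<theta>. node_count \<theta> = N}"

lemma finite_trees: "finite (trees N)"
proof (induction N rule: less_induct)
  case (less N)
  let ?S = "\<Union>m<N. trees m"
  have len: "length ts \<le> sum_list (map node_count ts)" for ts
  proof (induction ts)
    case (Cons t ts)
    then show ?case by (cases t) auto
  qed simp
  have "trees N \<subseteq> Node ` {ts. set ts \<subseteq> ?S \<and> length ts \<le> N}"
  proof
    fix \<theta> assume "\<theta> \<in> trees N"
    moreover obtain ts where "\<theta> = Node ts" by (cases \<theta>)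
    ultimately have N: "N = Suc (sum_list (map node_count ts))" by (simp add: trees_def)
    have "node_count t \<le> sum_list (map node_count ts)" if "t \<in> set ts" for t
      using that by (intro member_le_sum_list) auto
    then have "set ts \<subseteq> ?S" using N by (fastforce simp: trees_def)
    moreover have "length ts \<le> N" using len[of ts] N by simp
    ultimately show "\<theta> \<in> Node ` {ts. set ts \<subseteq> ?S \<and> length ts \<le> N}"
      using \<open>\<theta> = Node ts\<close> by blast
  qed
  moreover have "finite ?S" using less by blast
  ultimately show ?case
    by (auto intro: finite_subset[OF _ finite_imageI[OF finite_lists_length_le]])
qed

primrec tree_val ::
  "('k::complete_ultrametric_field ^ 'n::finite \<Rightarrow> 'k ^ 'l::finite ^ 'n) \<Rightarrow> 'k ^ 'l \<Rightarrow> 'k ^ 'n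
     \<Rightarrow> otree \<Rightarrow> 'k ^ 'n" where
  "tree_val A u w (Node ts) =
     (if ts = [] then A w *v u
      else (1 / fact (length ts)) *s (matrix_differential A w (map (tree_val A u w) ts) *v u))"

definition tree_term ::
  "('k::complete_ultrametric_field ^ 'n::finite \<Rightarrow> 'k ^ 'l::finite ^ 'n) \<Rightarrow> 'k ^ 'l \<Rightarrow> 'k ^ 'n
     \<Rightarrow> nat \<Rightarrow> 'k ^ 'n" where
  "tree_term A u w N = (\<Sum>\<theta>\<in>trees N. tree_val A u w \<theta>)"

text \<open>The index of \<^const>\<open>suminf\<close> is shifted: the sum is over tree sizes \<open>N \<ge> 1\<close>.\<close>

definition tree_sum ::
  "('k::complete_ultrametric_field ^ 'n::finite \<Rightarrow> 'k ^ 'l::finite ^ 'n) \<Rightarrow> 'k ^ 'l \<Rightarrow> 'k ^ 'n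
     \<Rightarrow> 'k ^ 'n" where
  "tree_sum A u w = w + (\<Sum>N. tree_term A u w (Suc N))"

definition series_matrix ::
  "('n \<Rightarrow> ('k::complete_ultrametric_field, 'n::finite, 'l::finite) pseries) \<Rightarrow> 'k ^ 'n
     \<Rightarrow> 'k ^ 'l ^ 'n" where
  "series_matrix G w = (\<chi> i. pseries_eval (G i) w)"

text \<open>The product \<open>k\<^sup>l \<times> k\<^sup>n\<close> is identified with \<open>'k ^ ('l + 'n)\<close>, whose sup-norm is the maximum
  of the two sup-norms.\<close>

definition left_part :: "'k ^ ('l::finite + 'n::finite) \<Rightarrow> 'k ^ 'l" where
  "left_part z = (\<chi> j. z $ Inl j)"

definition right_part :: "'k ^ ('l::finite + 'n::finite) \<Rightarrow> 'k ^ 'n" where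
  "right_part z = (\<chi> i. z $ Inr i)"

end

theory Submission
  imports Defs "HOL-Combinatorics.Multiset_Permutations" "HOL-Library.Function_Algebras"
begin

text \<open>Let \<open>T\<^sub>N\<close> be the sum of the values of all trees with \<open>N\<close> nodes. The values of single trees
  cannot be bounded usefully, because \<open>1 / t!\<close> may have a huge absolute value when the residue characteristic is positive. What saves the
  estimate is that the trees are ordered: with a tuple of subtrees at the root, all its
  reorderings occur as well. If the multi-linear form \<open>d\<^sup>tG(w)\<close> is expanded in coordinates, the
  \<open>t! / \<alpha>!\<close> lists of coordinates with multiplicities \<open>\<alpha>\<close> contribute equally, \<open>t!\<close> cancels, and there
  remain the divided derivatives \<open>c\<^sub>\<alpha>(w) = D\<^sup>\<alpha>G(w) / \<alpha>!\<close>, whose coefficients are integer multiples of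
  those of \<open>G\<close>. Since concatenating forests multiplies generating functions, this shows
  (\<open>tree_term_recursion\<close>) that \<open>T\<^bsub>m + 1\<^esub>\<close> is the coefficient of \<open>X\<^sup>m\<close> in
  \<open>\<Sum>\<^sub>\<alpha> c\<^sub>\<alpha>(w) h\<^sup>\<alpha> u\<close>, where \<open>h = \<Sum>\<^bsub>N \<ge> 1\<^esub> T\<^sub>N X\<^sup>N\<close>.

  Fix radii \<open>\<sigma> < R / M\<close> for \<open>u\<close> and \<open>\<tau> < R\<close> for \<open>w\<close> and put \<open>q = \<sigma> M / R < 1\<close>. As
  \<open>c\<^sub>\<alpha>\<close> is bounded by \<open>M / R\<^bsup>|\<alpha>|\<^esup>\<close>, the recursion shows inductively that each component of \<open>T\<^sub>N\<close> is
  the sum of a single power series in \<open>(u, w)\<close> with Gauss norm at most \<open>R q\<^sup>N\<close>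
  (\<open>bounded_analytic_tree_term\<close>). Existence and analyticity follow from this bound. The series
  \<open>v = \<Sum>T\<^sub>N\<close> converges to a vector of norm less than \<open>R\<close>, and exchanging summations in the sum of
  the recursion over \<open>m\<close> turns the right-hand side into the Taylor series of \<open>G(w + v) u\<close>, so that
  \<open>w + v\<close> solves the equation (\<open>correction_fixed_point\<close>). The sum over \<open>N\<close> of the power series of the
  \<open>T\<^sub>N\<close> is a power series for \<open>H\<close> on the whole polydisc, which can be re-expanded at each of its points
  (\<open>bounded_analytic_tree_sum\<close>, \<open>bounded_analytic_expansion\<close>). Uniqueness holds because
  \<open>h \<mapsto> w + G(h) u\<close> contracts distances by the factor \<open>\<parallel>u\<parallel> M / R < 1\<close> (\<open>solution_unique\<close>).\<close>

section \<open>The absolute value\<close>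

lemma absv_zero_iff [simp]: "absv (x :: 'k::complete_ultrametric_field) = 0 \<longleftrightarrow> x = 0"
proof -
  have "absv x = dist x 0" by (simp add: dist_absv)
  then show ?thesis by simp
qed

lemma absv_zero [simp]: "absv (0 :: 'k::complete_ultrametric_field) = 0"
  by simp

lemma absv_eq_dist: "absv (x :: 'k::complete_ultrametric_field) = dist x 0"
  by (simp add: dist_absv)

lemma absv_nonneg [simp]: "0 \<le> absv (x :: 'k::complete_ultrametric_field)"
  by (simp add: absv_eq_dist)

lemma absv_one [simp]: "absv (1 :: 'k::complete_ultrametric_field) = 1"
  using absv_mult[of "1::'k" 1] by simp

lemma absv_minus [simp]: "absv (- x :: 'k::complete_ultrametric_field) = absv x"
  using dist_absv[of x 0] dist_absv[of 0 x] by (simp add: dist_commute)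

lemma absv_power: "absv (x ^ n :: 'k::complete_ultrametric_field) = absv x ^ n"
  by (induction n) (auto simp: absv_mult)

lemma absv_prod: "absv (\<Prod>i\<in>S. f i :: 'k::complete_ultrametric_field) = (\<Prod>i\<in>S. absv (f i))"
  by (induction S rule: infinite_finite_induct) (auto simp: absv_mult)

lemma absv_diff_le: "absv (x - y :: 'k::complete_ultrametric_field) \<le> max (absv x) (absv y)"
  using absv_ultrametric[of x "- y"] by simp

lemma absv_sum_le:
  assumes "\<And>i. i \<in> S \<Longrightarrow> absv (f i :: 'k::complete_ultrametric_field) \<le> B" "0 \<le> B"
  shows "absv (\<Sum>i\<in>S. f i) \<le> B"
  using assms(1)
proof (induction S rule: infinite_finite_induct)
  case (insert x F)
  then have "max (absv (f x)) (absv (sum f F)) \<le> B" by simp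
  with absv_ultrametric have "absv (f x + sum f F) \<le> B" by (rule order_trans)
  then show ?case using insert.hyps by simp
qed (auto simp: \<open>0 \<le> B\<close>)

lemma absv_of_nat_le: "absv (of_nat n :: 'k::complete_ultrametric_field) \<le> 1"
  using absv_sum_le[of "{..<n}" "\<lambda>_. 1 :: 'k" 1] by simp

lemma uniformity_absv:
  "eventually P (uniformity :: ('k::complete_ultrametric_field \<times> 'k) filter) \<longleftrightarrow>
     (\<exists>e>0. \<forall>x y. absv (x - y) < e \<longrightarrow> P (x, y))"
  by (simp add: eventually_uniformity_metric dist_absv)

lemma tendsto_absv:
  "(f \<longlongrightarrow> (l :: 'k::complete_ultrametric_field)) F \<longleftrightarrow> (\<forall>e>0. \<forall>\<^sub>F x in F. absv (f x - l) < e)"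
  by (simp add: tendsto_iff dist_absv)

text \<open>By the ultrametric inequality the field operations are continuous for the metric. Registering
  this with the topological type classes makes the laws of unconditional summation (sums, multiples,
  iterated sums) available for \<open>k\<close>.\<close>

lemma tendsto_add_ultrametric:
  fixes a b :: "'k::complete_ultrametric_field"
  shows "((\<lambda>x. fst x + snd x) \<longlongrightarrow> a + b) (nhds a \<times>\<^sub>F nhds b)"
  unfolding tendsto_absv
proof (intro allI impI)
  fix e :: real assume "e > 0"
  have 1: "\<forall>\<^sub>F x in nhds a. absv (x - a) < e" for a :: 'k
    using filterlim_ident[of "nhds a"] \<open>e > 0\<close> unfolding tendsto_absv by blast
  have "\<forall>\<^sub>F x in nhds a \<times>\<^sub>F nhds b. absv (fst x - a) < e \<and> absv (snd x - b) < e"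
    unfolding eventually_prod_filter using 1[of a] 1[of b] by fastforce
  then show "\<forall>\<^sub>F x in nhds a \<times>\<^sub>F nhds b. absv (fst x + snd x - (a + b)) < e"
  proof eventually_elim
    case (elim x)
    have "fst x + snd x - (a + b) = (fst x - a) + (snd x - b)" by simp
    then show ?case
      using elim absv_ultrametric[of "fst x - a" "snd x - b"] by (metis le_less_trans max_less_iff_conj)
  qed
qed

instance complete_ultrametric_field \<subseteq> topological_comm_monoid_add
  by standard (rule tendsto_add_ultrametric)

instance complete_ultrametric_field \<subseteq> topological_ab_group_add
proof
  show "(uminus \<longlongrightarrow> - a) (nhds a)" for a :: 'a
    unfolding tendsto_absv
  proof (intro allI impI)
    fix e :: real assume "e > 0"
    then have "\<forall>\<^sub>F x in nhds a. absv (x - a) < e"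
      using filterlim_ident[of "nhds a"] unfolding tendsto_absv by blast
    then show "\<forall>\<^sub>F x in nhds a. absv (- x - - a) < e"
    proof eventually_elim
      case (elim x)
      have "- x - - a = - (x - a)" by simp
      then show ?case using elim by (simp only: absv_minus)
    qed
  qed
qed

instance complete_ultrametric_field \<subseteq> uniform_topological_group_add
proof (intro_classes, goal_cases)
  case 1
  show ?case
    unfolding filterlim_iff case_prod_unfold
  proof (intro allI impI)
    fix P :: "'a \<times> 'a \<Rightarrow> bool" assume "eventually P uniformity"
    then obtain e where "e > 0" and e: "\<And>x y. absv (x - y) < e \<Longrightarrow> P (x, y)"
      unfolding uniformity_absv by blast
    have Q: "eventually (\<lambda>(x, y). absv (x - y) < e) (uniformity :: ('a \<times> 'a) filter)"
      unfolding uniformity_absv using \<open>e > 0\<close> by auto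
    have "P (a + c, b + d)" if "absv (a - b) < e" "absv (c - d) < e" for a b c d
    proof -
      have "(a + c) - (b + d) = (a - b) + (c - d)" by simp
      then show ?thesis using that absv_ultrametric[of "a - b" "c - d"] by (intro e) (simp only:)
    qed
    then show "\<forall>\<^sub>F x in uniformity \<times>\<^sub>F uniformity.
                 P (fst (fst x) + fst (snd x), snd (fst x) + snd (snd x))"
      unfolding eventually_prod_filter
      by (intro exI[of _ "\<lambda>(x, y). absv (x - y) < e"] conjI) (use Q in auto)
  qed
next
  case 2
  have "absv (- a - - b) = absv (a - b)" for a b :: 'a
    using absv_minus[of "a - b"] by (simp only: minus_diff_minus)
  then show ?case
    unfolding filterlim_iff uniformity_absv case_prod_unfold fst_conv snd_conv by metis
qed

instance complete_ultrametric_field \<subseteq> topological_semigroup_mult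
proof
  fix a b :: 'a
  show "((\<lambda>x. fst x * snd x) \<longlongrightarrow> a * b) (nhds a \<times>\<^sub>F nhds b)"
    unfolding tendsto_absv
  proof (intro allI impI)
    fix e :: real assume "e > 0"
    define d where "d = min 1 (e / (1 + absv a + absv b))"
    have pos: "1 + absv a + absv b > 0" using absv_nonneg[of a] absv_nonneg[of b] by linarith
    then have "d > 0" using \<open>e > 0\<close> by (simp add: d_def)
    have d_le: "d * (1 + absv a + absv b) \<le> e"
    proof -
      have "d * (1 + absv a + absv b) \<le> e / (1 + absv a + absv b) * (1 + absv a + absv b)"
        unfolding d_def using pos by (intro mult_right_mono) auto
      then show ?thesis using pos by simp
    qed
    have 1: "\<forall>\<^sub>F x in nhds a. absv (x - a) < d" for a :: 'a
      using filterlim_ident[of "nhds a"] \<open>d > 0\<close> unfolding tendsto_absv by blast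
    have "\<forall>\<^sub>F x in nhds a \<times>\<^sub>F nhds b. absv (fst x - a) < d \<and> absv (snd x - b) < d"
      unfolding eventually_prod_filter using 1[of a] 1[of b] by fastforce
    then show "\<forall>\<^sub>F x in nhds a \<times>\<^sub>F nhds b. absv (fst x * snd x - a * b) < e"
    proof eventually_elim
      case (elim x)
      let ?p = "fst x - a" and ?q = "snd x - b"
      have lt: "c * t < e" if "0 \<le> c" "c < d" "0 \<le> t" "t \<le> 1 + absv a + absv b" for c t
      proof -
        have "c * t \<le> c * (1 + absv a + absv b)" using that by (intro mult_left_mono) auto
        also have "\<dots> < d * (1 + absv a + absv b)" using that pos by (intro mult_strict_right_mono)
        finally show ?thesis using d_le by simp
      qed
      have "absv ?q \<le> 1" using elim d_def by simp
      then have "absv (?p * ?q) < e" "absv (?p * b) < e" "absv (?q * a) < e"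
        unfolding absv_mult using elim by (auto intro!: lt simp: add_increasing add_increasing2)
      moreover have "fst x * snd x - a * b = ?p * ?q + (?p * b + ?q * a)" by (simp add: algebra_simps)
      ultimately show ?case
        using absv_ultrametric[of "?p * ?q" "?p * b + ?q * a"] absv_ultrametric[of "?p * b" "?q * a"]
        by simp
    qed
  qed
qed

section \<open>Unconditional sums dominated by a convergent real series\<close>

lemma finite_large_terms:
  assumes g: "g summable_on A" and nn: "\<And>x. x \<in> A \<Longrightarrow> 0 \<le> (g x :: real)" and "e > 0"
  shows "finite {x \<in> A. e \<le> g x}"
proof (rule ccontr)
  assume inf: "infinite {x \<in> A. e \<le> g x}"
  obtain n :: nat where n: "infsum g A < n * e"
    using reals_Archimedean3[OF \<open>e > 0\<close>] by blast
  obtain T where T: "finite T" "card T = n" "T \<subseteq> {x \<in> A. e \<le> g x}"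
    using infinite_arbitrarily_large[OF inf] by blast
  have "n * e = (\<Sum>x\<in>T. e)" using T by simp
  also have "\<dots> \<le> sum g T" using T by (intro sum_mono) auto
  also have "\<dots> \<le> infsum g A" using T g nn by (intro finite_sum_le_infsum) auto
  finally show False using n by simp
qed

text \<open>The difference of two partial sums over index sets that both contain the finitely many terms of
  size at least \<open>e / 2\<close> has absolute value at most \<open>e / 2\<close>, so the partial sums form a Cauchy
  filter. Domination by a summable real family is more than convergence to zero, but it is
  available for all families below because they are bounded by geometric ones, and it is stable under
  products of index sets.\<close>

lemma summable_on_dominated:
  fixes f :: "'a \<Rightarrow> 'k::complete_ultrametric_field"
  assumes g: "g summable_on A" and le: "\<And>x. x \<in> A \<Longrightarrow> absv (f x) \<le> g x"
  shows "f summable_on A"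
proof -
  have nn: "0 \<le> g x" if "x \<in> A" for x using le[OF that] absv_nonneg[of "f x"] by linarith
  have "\<exists>P. eventually P (finite_subsets_at_top A) \<and>
          (\<forall>F F'. P F \<and> P F' \<longrightarrow> dist (sum f F) (sum f F') < e)" if "e > 0" for e
  proof -
    define L where "L = {x \<in> A. e / 2 \<le> g x}"
    have "finite L" unfolding L_def by (rule finite_large_terms[OF g nn]) (use that in auto)
    have small: "absv (sum f F - sum f L) \<le> e / 2" if "finite F" "L \<subseteq> F" "F \<subseteq> A" for F
    proof -
      have "sum f F - sum f L = sum f (F - L)" using that \<open>finite L\<close> by (simp add: sum_diff)
      also have "absv \<dots> \<le> e / 2"
        using that \<open>e > 0\<close> le unfolding L_def by (intro absv_sum_le) (force intro: order_trans[OF le])+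
      finally show ?thesis .
    qed
    have "dist (sum f F) (sum f F') < e"
      if "finite F" "L \<subseteq> F" "F \<subseteq> A" "finite F'" "L \<subseteq> F'" "F' \<subseteq> A" for F F'
    proof -
      have "sum f F - sum f F' = (sum f F - sum f L) - (sum f F' - sum f L)" by simp
      moreover have "max (absv (sum f F - sum f L)) (absv (sum f F' - sum f L)) \<le> e / 2"
        using small that by (intro max.boundedI) auto
      ultimately have "absv (sum f F - sum f F') \<le> e / 2"
        using absv_diff_le[of "sum f F - sum f L" "sum f F' - sum f L"] by simp
      then show ?thesis using \<open>e > 0\<close> by (simp add: dist_absv)
    qed
    then show ?thesis
      by (intro exI[of _ "\<lambda>F. finite F \<and> L \<subseteq> F \<and> F \<subseteq> A"])
         (use \<open>finite L\<close> L_def in \<open>auto simp: eventually_finite_subsets_at_top\<close>)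
  qed
  then have "cauchy_filter (filtermap (sum f) (finite_subsets_at_top A))"
    by (simp add: cauchy_filter_metric_filtermap)
  moreover have "complete (UNIV :: 'k set)"
    by (meson Cauchy_convergent UNIV_I complete_def convergent_def)
  ultimately obtain l where "(sum f \<longlongrightarrow> l) (finite_subsets_at_top A)"
    using complete_uniform[where S = "UNIV :: 'k set"] by (force simp: filterlim_def)
  then show ?thesis by (auto simp: summable_on_def has_sum_def)
qed

lemma absv_has_sum_le:
  fixes f :: "'a \<Rightarrow> 'k::complete_ultrametric_field"
  assumes "(f has_sum s) A" "\<And>x. x \<in> A \<Longrightarrow> absv (f x) \<le> B" "0 \<le> B"
  shows "absv s \<le> B"
proof (rule ccontr)
  assume "\<not> absv s \<le> B"
  then have "absv s > 0" using \<open>0 \<le> B\<close> by linarith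
  then obtain F where F: "finite F" "F \<subseteq> A" "dist (sum f F) s \<le> absv s / 2"
    using has_sum_finite_approximation[OF assms(1), of "absv s / 2"] by auto
  have "absv (sum f F) \<le> B" using F assms by (intro absv_sum_le) auto
  moreover have "s = sum f F - (sum f F - s)" by simp
  ultimately show False
    using absv_diff_le[of "sum f F" "sum f F - s"] F(3) \<open>\<not> absv s \<le> B\<close> \<open>absv s > 0\<close>
    by (simp add: dist_absv)
qed

lemma absv_infsum_le:
  fixes f :: "'a \<Rightarrow> 'k::complete_ultrametric_field"
  assumes "\<And>x. x \<in> A \<Longrightarrow> absv (f x) \<le> B" "0 \<le> B"
  shows "absv (infsum f A) \<le> B"
  using absv_has_sum_le[OF has_sum_infsum, of f A B] assms by (cases "f summable_on A") (auto simp: infsum_not_exists)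

lemma summable_on_product:
  fixes g :: "'a \<Rightarrow> real" and h :: "'b \<Rightarrow> real"
  assumes "g summable_on A" "h summable_on B" "\<And>x. x \<in> A \<Longrightarrow> 0 \<le> g x" "\<And>y. y \<in> B \<Longrightarrow> 0 \<le> h y"
  shows "(\<lambda>(x, y). g x * h y) summable_on A \<times> B"
  by (rule summable_on_SigmaI[where g = "\<lambda>x. g x * infsum h B"])
     (use assms in \<open>auto intro!: has_sum_cmult_right summable_on_cmult_left\<close>)

text \<open>A double family dominated by a product of summable families is unconditionally summable on the
  product, so every order of summation gives the same result. In \<open>has_sum_fibres\<close> the double index set is
  cut into finite pieces, the piece for \<open>c\<close> being the graph of \<open>d c\<close> on \<open>D c\<close>; antidiagonals are the
  main example (Cauchy products, the binomial theorem in Taylor's formula).\<close>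

lemma
  fixes f :: "'a \<Rightarrow> 'b \<Rightarrow> 'k::complete_ultrametric_field"
  assumes g: "g summable_on UNIV" and h: "h summable_on UNIV"
    and le: "\<And>x y. absv (f x y) \<le> g x * h y" and nn: "\<And>x. 0 \<le> g x" "\<And>y. 0 \<le> h y"
  shows has_sum_rows: "((\<lambda>x. \<Sum>\<^sub>\<infinity>y. f x y) has_sum (\<Sum>\<^sub>\<infinity>(x, y). f x y)) UNIV"
    and infsum_swap_dominated: "(\<Sum>\<^sub>\<infinity>x. \<Sum>\<^sub>\<infinity>y. f x y) = (\<Sum>\<^sub>\<infinity>y. \<Sum>\<^sub>\<infinity>x. f x y)"
    and has_sum_fibres: "\<And>(D :: 'c \<Rightarrow> 'a set) d. (\<And>c. finite (D c)) \<Longrightarrow>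
           bij_betw (\<lambda>(c, x). (x, d c x)) (Sigma UNIV D) UNIV \<Longrightarrow>
           ((\<lambda>c. \<Sum>x\<in>D c. f x (d c x)) has_sum (\<Sum>\<^sub>\<infinity>x. \<Sum>\<^sub>\<infinity>y. f x y)) UNIV"
proof -
  let ?S = "\<Sum>\<^sub>\<infinity>(x, y). f x y"
  have row: "f x summable_on UNIV" for x
    by (rule summable_on_dominated[OF summable_on_cmult_right[OF h, of "g x"]]) (rule le)
  have col: "(\<lambda>x. f x y) summable_on UNIV" for y
    by (rule summable_on_dominated[OF summable_on_cmult_left[OF g, of "h y"]]) (rule le)
  have "(\<lambda>(x, y). f x y) summable_on UNIV \<times> UNIV"
    by (rule summable_on_dominated[OF summable_on_product[OF g h nn]]) (auto intro: le)
  then have all: "((\<lambda>(x, y). f x y) has_sum ?S) (UNIV \<times> UNIV)"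
    by (simp add: has_sum_infsum)
  note plus = uniformly_continuous_add[where 'a = 'k]
  show rows: "((\<lambda>x. \<Sum>\<^sub>\<infinity>y. f x y) has_sum ?S) UNIV"
    by (rule has_sum_Sigma[OF plus all]) (use row in \<open>auto intro: has_sum_infsum\<close>)
  have all': "((\<lambda>(y, x). f x y) has_sum ?S) (UNIV \<times> UNIV)"
    using all by (subst (asm) has_sum_swap) simp
  have cols: "((\<lambda>y. \<Sum>\<^sub>\<infinity>x. f x y) has_sum ?S) UNIV"
    by (rule has_sum_Sigma[OF plus all']) (use col in \<open>auto intro: has_sum_infsum\<close>)
  show "(\<Sum>\<^sub>\<infinity>x. \<Sum>\<^sub>\<infinity>y. f x y) = (\<Sum>\<^sub>\<infinity>y. \<Sum>\<^sub>\<infinity>x. f x y)"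
    using rows cols by (simp add: infsumI)
  fix D :: "'c \<Rightarrow> 'a set" and d :: "'c \<Rightarrow> 'a \<Rightarrow> 'b"
  assume fin: "\<And>c. finite (D c)" and bij: "bij_betw (\<lambda>(c, x). (x, d c x)) (Sigma UNIV D) UNIV"
  have "((\<lambda>p. (\<lambda>(x, y). f x y) ((\<lambda>(c, x). (x, d c x)) p)) has_sum ?S) (Sigma UNIV D)"
    using all by (subst has_sum_reindex_bij_betw[OF bij]) simp
  then have "((\<lambda>c. \<Sum>x\<in>D c. f x (d c x)) has_sum ?S) UNIV"
    by (rule has_sum_Sigma[OF plus]) (use fin in auto)
  then show "((\<lambda>c. \<Sum>x\<in>D c. f x (d c x)) has_sum (\<Sum>\<^sub>\<infinity>x. \<Sum>\<^sub>\<infinity>y. f x y)) UNIV"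
    using rows by (simp add: infsumI)
qed

section \<open>Multi-indices and power series with bounded coefficients\<close>

definition mpow :: "('v::finite \<Rightarrow> 'a::comm_monoid_mult) \<Rightarrow> ('v \<Rightarrow> nat) \<Rightarrow> 'a" where
  "mpow x \<alpha> = (\<Prod>i\<in>UNIV. x i ^ \<alpha> i)"

definition unit_index :: "'v \<Rightarrow> 'v \<Rightarrow> nat" where
  "unit_index i = (\<lambda>j. if j = i then 1 else 0)"

lemma mpow_zero [simp]: "mpow x 0 = 1"
  by (simp add: mpow_def)

lemma mpow_add: "mpow x (\<alpha> + \<beta>) = mpow x \<alpha> * mpow x \<beta>"
  by (simp add: mpow_def power_add prod.distrib)

lemma mpow_mult: "mpow (\<lambda>i. x i * y i) \<alpha> = mpow x \<alpha> * mpow y \<alpha>"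
  by (simp add: mpow_def power_mult_distrib prod.distrib)

lemma mpow_divide: "mpow (\<lambda>i. x i / (y i :: real)) \<alpha> = mpow x \<alpha> / mpow y \<alpha>"
  by (simp add: mpow_def power_divide prod_dividef)

lemma mpow_const: "mpow (\<lambda>_. c) \<alpha> = c ^ degree_of \<alpha>"
  by (simp add: mpow_def degree_of_def power_sum)

lemma mpow_unit_index [simp]: "mpow x (unit_index i) = x i"
proof -
  have "mpow x (unit_index i) = (\<Prod>j\<in>UNIV. if j = i then x j else 1)"
    unfolding mpow_def unit_index_def by (rule prod.cong) auto
  then show ?thesis by simp
qed

lemma absv_mpow: "absv (mpow x \<alpha> :: 'k::complete_ultrametric_field) = mpow (\<lambda>i. absv (x i)) \<alpha>"
  by (simp add: mpow_def absv_prod absv_power)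

lemma mpow_nonneg: "(\<And>i. 0 \<le> x i) \<Longrightarrow> 0 \<le> mpow x \<alpha>" for x :: "'v::finite \<Rightarrow> real"
  by (simp add: mpow_def prod_nonneg)

lemma mpow_pos: "(\<And>i. 0 < x i) \<Longrightarrow> 0 < mpow x \<alpha>" for x :: "'v::finite \<Rightarrow> real"
  by (simp add: mpow_def prod_pos)

lemma mpow_mono: "(\<And>i. 0 \<le> x i) \<Longrightarrow> (\<And>i. x i \<le> y i) \<Longrightarrow> mpow x \<alpha> \<le> mpow y \<alpha>"
  for x y :: "'v::finite \<Rightarrow> real"
  unfolding mpow_def by (intro prod_mono conjI power_mono zero_le_power) auto

lemma atMost_multi_index: "{..\<gamma> :: 'v::finite \<Rightarrow> nat} = (\<Pi>\<^sub>E i\<in>UNIV. {..\<gamma> i})"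
  by (auto simp: le_fun_def PiE_def Pi_def)

lemma finite_atMost_multi_index [simp]: "finite {..\<gamma> :: 'v::finite \<Rightarrow> nat}"
  unfolding atMost_multi_index by (intro finite_PiE) auto

lemma bij_antidiagonal:
  "bij_betw (\<lambda>(\<gamma>, \<alpha>). (\<alpha>, \<gamma> - \<alpha>)) (Sigma UNIV (\<lambda>\<gamma>. {..\<gamma> :: 'v \<Rightarrow> nat})) UNIV"
  by (rule bij_betw_byWitness[where f' = "\<lambda>(\<alpha>, \<beta>). (\<alpha> + \<beta>, \<alpha>)"]) (auto simp: le_fun_def fun_eq_iff)

lemma bij_antidiagonal_nat:
  "bij_betw (\<lambda>(m, i). (i, m - i)) (Sigma UNIV (\<lambda>m. {..m :: nat})) UNIV"
  by (rule bij_betw_byWitness[where f' = "\<lambda>(i, j). (i + j, i)"]) auto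

lemma add_diff_multi_index: "\<alpha> \<le> \<gamma> \<Longrightarrow> \<alpha> + (\<gamma> - \<alpha>) = (\<gamma> :: 'v \<Rightarrow> nat)"
  by (auto simp: le_fun_def fun_eq_iff)

text \<open>A finite set of multi-indices lies in a box, over which the sum factors into finite geometric sums.\<close>

lemma summable_on_mpow:
  fixes q :: "'v::finite \<Rightarrow> real"
  assumes q: "\<And>i. 0 \<le> q i" "\<And>i. q i < 1"
  shows "mpow q summable_on UNIV"
proof -
  have geo: "(\<Sum>k\<in>{..N}. q i ^ k) \<le> 1 / (1 - q i)" for i N
    using sum_le_suminf[of "\<lambda>k. q i ^ k" "{..N}"] q[of i]
    by (simp add: summable_geometric suminf_geometric)
  have "sum (mpow q) X \<le> (\<Prod>i\<in>UNIV. 1 / (1 - q i))" if "finite X" for X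
  proof -
    define N where "N = Max (insert 0 ((\<lambda>(\<alpha>, i). \<alpha> i) ` (X \<times> UNIV)))"
    have "\<alpha> i \<le> N" if "\<alpha> \<in> X" for \<alpha> i
      unfolding N_def using that \<open>finite X\<close> by (intro Max_ge) (auto intro!: image_eqI[of _ _ "(\<alpha>, i)"])
    then have "X \<subseteq> (\<Pi>\<^sub>E i\<in>UNIV. {..N})" by auto
    then have "sum (mpow q) X \<le> sum (mpow q) (\<Pi>\<^sub>E i\<in>UNIV. {..N})"
      using q by (intro sum_mono2 finite_PiE mpow_nonneg) auto
    also have "\<dots> = (\<Prod>i\<in>UNIV. \<Sum>k\<in>{..N}. q i ^ k)"
      by (subst prod_sum_PiE) (auto simp: mpow_def)
    also have "\<dots> \<le> (\<Prod>i\<in>UNIV. 1 / (1 - q i))"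
      using geo q by (intro prod_mono conjI sum_nonneg) auto
    finally show ?thesis .
  qed
  then show ?thesis
    using q by (intro nonneg_bdd_above_summable_on bdd_aboveI2 mpow_nonneg) auto
qed

text \<open>Each variable has its own radius because the series in \<open>u\<close> and \<open>w\<close> jointly live on a product of
  balls of unrelated radii. In \<open>coeff_bounded\<close> the number \<open>C\<close> bounds the Gauss norm for the
  polyradius \<open>s\<close>; a finite Gauss norm implies convergence on the open polydisc, since the terms are
  then dominated by a geometric family (\<open>coeff_bounded_term_le\<close>).\<close>

definition polydisc :: "('v \<Rightarrow> real) \<Rightarrow> ('v \<Rightarrow> 'k::complete_ultrametric_field) set" where
  "polydisc s = {x. \<forall>i. absv (x i) < s i}"

definition coeff_bounded ::
  "('v::finite \<Rightarrow> real) \<Rightarrow> real \<Rightarrow> (('v \<Rightarrow> nat) \<Rightarrow> 'k::complete_ultrametric_field) \<Rightarrow> bool" where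
  "coeff_bounded s C F \<longleftrightarrow> (\<forall>\<alpha>. absv (F \<alpha>) * mpow s \<alpha> \<le> C)"

definition ps_eval ::
  "(('v::finite \<Rightarrow> nat) \<Rightarrow> 'k::complete_ultrametric_field) \<Rightarrow> ('v \<Rightarrow> 'k) \<Rightarrow> 'k" where
  "ps_eval F x = (\<Sum>\<^sub>\<infinity>\<alpha>. F \<alpha> * mpow x \<alpha>)"

lemma polydisc_pos: "x \<in> polydisc s \<Longrightarrow> 0 < s i"
  by (auto simp: polydisc_def intro: le_less_trans[OF absv_nonneg])

lemma polydisc_add: "x \<in> polydisc s \<Longrightarrow> y \<in> polydisc s \<Longrightarrow> (\<lambda>i. x i + y i) \<in> polydisc s"
  by (auto simp: polydisc_def intro: le_less_trans[OF absv_ultrametric])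

lemma coeff_bounded_mono: "coeff_bounded s C F \<Longrightarrow> C \<le> D \<Longrightarrow> coeff_bounded s D F"
  by (auto simp: coeff_bounded_def intro: order_trans)

lemma coeff_bounded_nonneg: "coeff_bounded s C F \<Longrightarrow> 0 \<le> C"
  unfolding coeff_bounded_def using absv_nonneg[of "F 0"] by (metis mpow_zero mult.right_neutral order_trans)

definition radius_ratio :: "('v \<Rightarrow> real) \<Rightarrow> ('v \<Rightarrow> 'k::complete_ultrametric_field) \<Rightarrow> 'v \<Rightarrow> real" where
  "radius_ratio s x = (\<lambda>i. absv (x i) / s i)"

lemma radius_ratio_nonneg: "x \<in> polydisc s \<Longrightarrow> 0 \<le> mpow (radius_ratio s x) \<alpha>"
  using polydisc_pos[of x s] by (intro mpow_nonneg) (auto simp: radius_ratio_def intro!: divide_nonneg_pos)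

lemma summable_radius_ratio: "x \<in> polydisc s \<Longrightarrow> mpow (radius_ratio s x) summable_on UNIV"
  using polydisc_pos[of x s]
  by (intro summable_on_mpow) (auto simp: radius_ratio_def polydisc_def intro!: divide_nonneg_pos)

lemma radius_ratio_le_one: "x \<in> polydisc s \<Longrightarrow> mpow (radius_ratio s x) \<alpha> \<le> 1"
proof -
  assume x: "x \<in> polydisc s"
  have "mpow (radius_ratio s x) \<alpha> \<le> mpow (\<lambda>_. 1) \<alpha>"
    using x polydisc_pos[OF x]
    by (intro mpow_mono) (auto simp: radius_ratio_def polydisc_def less_imp_le intro!: divide_nonneg_pos)
  then show ?thesis by (simp add: mpow_const)
qed

lemma absv_mpow_ratio: "x \<in> polydisc s \<Longrightarrow> absv (mpow x \<alpha>) = mpow s \<alpha> * mpow (radius_ratio s x) \<alpha>"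
  using mpow_pos[of s \<alpha>] polydisc_pos[of x s]
  by (simp add: radius_ratio_def mpow_divide absv_mpow)

lemma coeff_bounded_term_le:
  assumes "coeff_bounded s C F" "x \<in> polydisc s"
  shows "absv (F \<alpha> * mpow x \<alpha>) \<le> C * mpow (radius_ratio s x) \<alpha>"
proof -
  have "absv (F \<alpha> * mpow x \<alpha>) = (absv (F \<alpha>) * mpow s \<alpha>) * mpow (radius_ratio s x) \<alpha>"
    using assms by (simp add: absv_mult absv_mpow_ratio)
  also have "\<dots> \<le> C * mpow (radius_ratio s x) \<alpha>"
    using assms by (intro mult_right_mono radius_ratio_nonneg) (auto simp: coeff_bounded_def)
  finally show ?thesis .
qed

lemma ps_eval_has_sum:
  assumes "coeff_bounded s C F" "x \<in> polydisc s"
  shows "((\<lambda>\<alpha>. F \<alpha> * mpow x \<alpha>) has_sum ps_eval F x) UNIV"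
  unfolding ps_eval_def
  by (intro has_sum_infsum summable_on_dominated[OF summable_on_cmult_right[OF summable_radius_ratio, of x s C]]
       coeff_bounded_term_le assms)

lemma absv_ps_eval_le:
  assumes "coeff_bounded s C F" "x \<in> polydisc s"
  shows "absv (ps_eval F x) \<le> C"
proof (rule absv_has_sum_le[OF ps_eval_has_sum[OF assms]])
  show "0 \<le> C" by (rule coeff_bounded_nonneg[OF assms(1)])
  then show "absv (F \<alpha> * mpow x \<alpha>) \<le> C" for \<alpha>
    using coeff_bounded_term_le[OF assms, of \<alpha>] radius_ratio_le_one[OF assms(2), of \<alpha>] mult_left_mono
    by fastforce
qed

section \<open>Taylor expansion and derivatives\<close>

text \<open>The coefficients of \<open>D\<^sup>\<alpha>F / \<alpha>!\<close>. They are integer multiples of coefficients of \<open>F\<close>, and integers have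
  absolute value at most 1. So dividing by \<open>\<alpha>!\<close> in this way costs nothing, whereas \<open>|1 / \<alpha>!|\<close> is
  unbounded when the residue characteristic is positive.\<close>

definition hasse :: "('v::finite \<Rightarrow> nat) \<Rightarrow> (('v \<Rightarrow> nat) \<Rightarrow> 'k::complete_ultrametric_field) \<Rightarrow> ('v \<Rightarrow> nat) \<Rightarrow> 'k" where
  "hasse \<alpha> F \<beta> = (\<Prod>i\<in>UNIV. of_nat ((\<alpha> i + \<beta> i) choose \<alpha> i)) * F (\<alpha> + \<beta>)"

lemma coeff_bounded_hasse:
  assumes F: "coeff_bounded s C F" and s: "\<And>i. 0 < s i"
  shows "coeff_bounded s (C / mpow s \<alpha>) (hasse \<alpha> F)"
  unfolding coeff_bounded_def
proof
  fix \<beta>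
  let ?b = "\<Prod>i\<in>UNIV. of_nat ((\<alpha> i + \<beta> i) choose \<alpha> i) :: 'b"
  have "absv ?b \<le> 1"
    unfolding absv_prod by (intro prod_le_1 conjI absv_nonneg absv_of_nat_le)
  then have "absv (hasse \<alpha> F \<beta>) \<le> absv (F (\<alpha> + \<beta>))"
    by (simp add: hasse_def absv_mult mult_left_le_one_le)
  then have "absv (hasse \<alpha> F \<beta>) * mpow s \<beta> * mpow s \<alpha> \<le> absv (F (\<alpha> + \<beta>)) * mpow s (\<alpha> + \<beta>)"
    using s by (simp add: mpow_add mpow_pos mult_ac)
  also have "\<dots> \<le> C" using F by (simp add: coeff_bounded_def)
  finally show "absv (hasse \<alpha> F \<beta>) * mpow s \<beta> \<le> C / mpow s \<alpha>"
    using s by (simp add: mpow_pos pos_le_divide_eq)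
qed

lemma multi_binomial:
  fixes x v :: "'v::finite \<Rightarrow> 'a::comm_ring_1"
  shows "mpow (\<lambda>i. x i + v i) \<gamma> =
    (\<Sum>\<alpha>\<in>{..\<gamma>}. (\<Prod>i\<in>UNIV. of_nat (\<gamma> i choose \<alpha> i)) * mpow x (\<gamma> - \<alpha>) * mpow v \<alpha>)"
proof -
  have "mpow (\<lambda>i. x i + v i) \<gamma> = (\<Prod>i\<in>UNIV. \<Sum>k\<in>{..\<gamma> i}. of_nat (\<gamma> i choose k) * v i ^ k * x i ^ (\<gamma> i - k))"
    unfolding mpow_def by (intro prod.cong refl) (subst add.commute, rule binomial_ring)
  also have "\<dots> = (\<Sum>\<alpha>\<in>{..\<gamma>}. \<Prod>i\<in>UNIV. of_nat (\<gamma> i choose \<alpha> i) * v i ^ \<alpha> i * x i ^ (\<gamma> i - \<alpha> i))"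
    by (subst prod_sum_PiE) (auto simp: atMost_multi_index)
  also have "\<dots> = (\<Sum>\<alpha>\<in>{..\<gamma>}. (\<Prod>i\<in>UNIV. of_nat (\<gamma> i choose \<alpha> i)) * mpow x (\<gamma> - \<alpha>) * mpow v \<alpha>)"
    by (simp add: mpow_def prod.distrib mult_ac)
  finally show ?thesis .
qed

text \<open>Expanding \<open>(x + v)\<^sup>\<gamma>\<close> by the binomial theorem makes the left-hand side the sum along rows, and
  \<open>F(x + v)\<close> the sum along antidiagonals, of one double family. As the ultrametric polydisc is closed under
  addition, both points may range over the full polydisc.\<close>

lemma taylor_has_sum:
  assumes F: "coeff_bounded s C F" and x: "x \<in> polydisc s" and v: "v \<in> polydisc s"
  shows "((\<lambda>\<alpha>. ps_eval (hasse \<alpha> F) x * mpow v \<alpha>) has_sum ps_eval F (\<lambda>i. x i + v i)) UNIV"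
proof -
  define f where "f \<alpha> \<beta> = hasse \<alpha> F \<beta> * mpow x \<beta> * mpow v \<alpha>" for \<alpha> \<beta>
  have s: "0 < s i" for i by (rule polydisc_pos[OF x])
  have bd: "absv (f \<alpha> \<beta>) \<le> (C * mpow (radius_ratio s v) \<alpha>) * mpow (radius_ratio s x) \<beta>" for \<alpha> \<beta>
  proof -
    have "absv (f \<alpha> \<beta>) = absv (hasse \<alpha> F \<beta> * mpow x \<beta>) * (mpow s \<alpha> * mpow (radius_ratio s v) \<alpha>)"
      by (simp add: f_def absv_mult absv_mpow_ratio[OF v])
    also have "\<dots> \<le> (C / mpow s \<alpha> * mpow (radius_ratio s x) \<beta>) * (mpow s \<alpha> * mpow (radius_ratio s v) \<alpha>)"
      using coeff_bounded_term_le[OF coeff_bounded_hasse[OF F s] x] s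
      by (intro mult_right_mono mult_nonneg_nonneg radius_ratio_nonneg[OF v] less_imp_le[OF mpow_pos]) auto
    also have "\<dots> = (C * mpow (radius_ratio s v) \<alpha>) * mpow (radius_ratio s x) \<beta>"
      using mpow_pos[of s \<alpha>] s by simp
    finally show ?thesis .
  qed
  note dom = summable_on_cmult_right[OF summable_radius_ratio[OF v], of C] summable_radius_ratio[OF x] bd
    mult_nonneg_nonneg[OF coeff_bounded_nonneg[OF F] radius_ratio_nonneg[OF v]] radius_ratio_nonneg[OF x]
  have row: "(\<Sum>\<^sub>\<infinity>\<beta>. f \<alpha> \<beta>) = ps_eval (hasse \<alpha> F) x * mpow v \<alpha>" for \<alpha>
    unfolding f_def
    by (intro infsumI has_sum_cmult_left ps_eval_has_sum[OF coeff_bounded_hasse[OF F s] x])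
  have diag: "(\<Sum>\<alpha>\<in>{..\<gamma>}. f \<alpha> (\<gamma> - \<alpha>)) = F \<gamma> * mpow (\<lambda>i. x i + v i) \<gamma>" for \<gamma>
    unfolding multi_binomial sum_distrib_left
  proof (rule sum.cong)
    fix \<alpha> assume "\<alpha> \<in> {..\<gamma>}"
    then have "\<alpha> \<le> \<gamma>" by simp
    moreover from this have "\<alpha> i + (\<gamma> i - \<alpha> i) = \<gamma> i" for i by (simp add: le_fun_def)
    ultimately show "f \<alpha> (\<gamma> - \<alpha>) =
        F \<gamma> * ((\<Prod>i\<in>UNIV. of_nat (\<gamma> i choose \<alpha> i)) * mpow x (\<gamma> - \<alpha>) * mpow v \<alpha>)"
      by (simp add: f_def hasse_def add_diff_multi_index mult_ac)
  qed simp
  have "((\<lambda>\<gamma>. F \<gamma> * mpow (\<lambda>i. x i + v i) \<gamma>) has_sum (\<Sum>\<^sub>\<infinity>\<alpha>. \<Sum>\<^sub>\<infinity>\<beta>. f \<alpha> \<beta>)) UNIV"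
    using has_sum_fibres[OF dom finite_atMost_multi_index bij_antidiagonal] by (simp add: diag)
  then have "ps_eval F (\<lambda>i. x i + v i) = (\<Sum>\<^sub>\<infinity>\<alpha>. \<Sum>\<^sub>\<infinity>\<beta>. f \<alpha> \<beta>)"
    unfolding ps_eval_def by (rule infsumI)
  moreover have "((\<lambda>\<alpha>. \<Sum>\<^sub>\<infinity>\<beta>. f \<alpha> \<beta>) has_sum (\<Sum>\<^sub>\<infinity>\<alpha>. \<Sum>\<^sub>\<infinity>\<beta>. f \<alpha> \<beta>)) UNIV"
    using has_sum_rows[OF dom] by (simp add: infsumI)
  ultimately show ?thesis by (simp add: row)
qed

text \<open>By the ultrametric inequality the remainder is bounded by the largest of the omitted terms. With
  \<open>S = {0}\<close> this is a Lipschitz estimate, with \<open>S\<close> the indices of the constant and one linear term it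
  gives a partial derivative.\<close>

lemma taylor_remainder_le:
  assumes F: "coeff_bounded s C F" and x: "x \<in> polydisc s" and v: "v \<in> polydisc s"
    and S: "finite S" and B: "0 \<le> B"
    and le: "\<And>\<alpha>. \<alpha> \<notin> S \<Longrightarrow> C * mpow (radius_ratio s v) \<alpha> \<le> B"
  shows "absv (ps_eval F (\<lambda>i. x i + v i) - (\<Sum>\<alpha>\<in>S. ps_eval (hasse \<alpha> F) x * mpow v \<alpha>)) \<le> B"
proof -
  let ?t = "\<lambda>\<alpha>. ps_eval (hasse \<alpha> F) x * mpow v \<alpha>"
  have s: "0 < s i" for i by (rule polydisc_pos[OF x])
  have t: "absv (?t \<alpha>) \<le> C * mpow (radius_ratio s v) \<alpha>" for \<alpha>
  proof -
    have "absv (?t \<alpha>) \<le> C / mpow s \<alpha> * (mpow s \<alpha> * mpow (radius_ratio s v) \<alpha>)"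
      unfolding absv_mult absv_mpow_ratio[OF v]
      using s by (intro mult_right_mono absv_ps_eval_le[OF coeff_bounded_hasse[OF F s] x]
          mult_nonneg_nonneg radius_ratio_nonneg[OF v] less_imp_le[OF mpow_pos])
    then show ?thesis using mpow_pos[of s \<alpha>] s by simp
  qed
  have "((\<lambda>\<alpha>. if \<alpha> \<in> S then ?t \<alpha> else 0) has_sum (\<Sum>\<alpha>\<in>S. ?t \<alpha>)) UNIV"
    by (rule has_sum_finite_neutralI[of S]) (use S in auto)
  from has_sum_add[OF taylor_has_sum[OF F x v] has_sum_uminusI[OF this]]
  have "((\<lambda>\<alpha>. ?t \<alpha> + - (if \<alpha> \<in> S then ?t \<alpha> else 0)) has_sum
          (ps_eval F (\<lambda>i. x i + v i) - (\<Sum>\<alpha>\<in>S. ?t \<alpha>))) UNIV"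
    by simp
  moreover have "(\<lambda>\<alpha>. ?t \<alpha> + - (if \<alpha> \<in> S then ?t \<alpha> else 0)) = (\<lambda>\<alpha>. if \<alpha> \<in> S then 0 else ?t \<alpha>)"
    by auto
  ultimately have "((\<lambda>\<alpha>. if \<alpha> \<in> S then 0 else ?t \<alpha>) has_sum
          (ps_eval F (\<lambda>i. x i + v i) - (\<Sum>\<alpha>\<in>S. ?t \<alpha>))) UNIV"
    by (simp only:)
  then show ?thesis
    by (rule absv_has_sum_le) (use le B in \<open>auto intro: order_trans[OF t]\<close>)
qed

text \<open>The powers of an element with \<open>0 < |x| < 1\<close> accumulate at 0; such an element exists because the
  absolute value is not trivial. This is what gives limits at 0 a determined value.\<close>

lemma at_zero_nontrivial: "at (0 :: 'k::complete_ultrametric_field) \<noteq> bot"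
proof -
  obtain x :: 'k where x: "x \<noteq> 0" "absv x < 1"
  proof -
    obtain y :: 'k where y: "y \<noteq> 0" "absv y \<noteq> 1" using absv_nontrivial by blast
    have "absv y * absv (inverse y) = 1" using y by (simp flip: absv_mult)
    moreover have "absv y > 0" "absv (inverse y) > 0" using y absv_nonneg[of y] absv_nonneg[of "inverse y"]
      by (auto simp: less_le simp del: absv_nonneg)
    ultimately have "absv y < 1 \<or> absv (inverse y) < 1"
      using y mult_strict_mono[of 1 "absv y" 1 "absv (inverse y)"] by force
    then show ?thesis using that[of y] that[of "inverse y"] y by auto
  qed
  have "\<not> (\<forall>\<^sub>F t in at (0 :: 'k). False)"
    unfolding eventually_at
  proof safe
    fix d :: real assume d: "d > 0" "\<forall>t\<in>UNIV. t \<noteq> 0 \<and> dist t (0 :: 'k) < d \<longrightarrow> False"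
    obtain n where "absv x ^ n < d" using real_arch_pow_inv[OF d(1) x(2)] by blast
    then show False using d(2)[rule_format, of "x ^ n"] x by (simp add: dist_absv absv_power)
  qed
  then show ?thesis by (simp add: trivial_limit_def)
qed

lemma hasse_zero [simp]: "hasse 0 F = F"
  by (simp add: hasse_def fun_eq_iff plus_fun_def)

lemma polydisc_axis:
  assumes "\<And>j. 0 < s j" "absv t < s i"
  shows "vec_nth (axis i t) \<in> polydisc s"
  using assms by (auto simp: polydisc_def axis_def)

lemma mpow_axis_ratio_le:
  assumes s: "\<And>j. 0 < s j" and t: "absv t < s i" and \<alpha>: "\<alpha> \<noteq> 0" "\<alpha> \<noteq> unit_index i"
  shows "mpow (radius_ratio s (vec_nth (axis i t))) \<alpha> \<le> (absv t / s i)\<^sup>2"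
proof (cases "\<exists>j. j \<noteq> i \<and> \<alpha> j \<noteq> 0")
  case True
  then have "mpow (radius_ratio s (vec_nth (axis i t))) \<alpha> = 0"
    unfolding mpow_def by (auto simp: radius_ratio_def axis_def intro!: prod_zero)
  then show ?thesis by simp
next
  case False
  then have zero: "\<alpha> j = 0" if "j \<noteq> i" for j using that by blast
  have "\<alpha> i \<noteq> 0"
  proof
    assume "\<alpha> i = 0"
    then have "\<alpha> j = 0" for j using zero by (cases "j = i") auto
    then show False using \<alpha>(1) by (auto simp: fun_eq_iff)
  qed
  moreover have "\<alpha> i \<noteq> 1"
  proof
    assume "\<alpha> i = 1"
    then have "\<alpha> j = unit_index i j" for j using zero by (cases "j = i") (auto simp: unit_index_def)
    then show False using \<alpha>(2) by (auto simp: fun_eq_iff)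
  qed
  ultimately have "2 \<le> \<alpha> i" by linarith
  have "mpow (radius_ratio s (vec_nth (axis i t))) \<alpha> = (\<Prod>j\<in>UNIV. if j = i then (absv t / s i) ^ \<alpha> i else 1)"
    unfolding mpow_def by (rule prod.cong) (auto simp: radius_ratio_def axis_def zero)
  also have "\<dots> = (absv t / s i) ^ \<alpha> i" by simp
  also have "\<dots> \<le> (absv t / s i)\<^sup>2"
    using s[of i] t \<open>2 \<le> \<alpha> i\<close> by (intro power_decreasing) auto
  finally show ?thesis .
qed

text \<open>Only the values of \<open>f\<close> in the polydisc matter, which allows the lemma to be iterated: derivatives are
  again given by power series in the polydisc, but not outside it.\<close>

lemma partial_deriv_ps_eval:
  fixes f :: "'k::complete_ultrametric_field ^ 'n::finite \<Rightarrow> 'k"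
  assumes F: "coeff_bounded s C F"
    and f: "\<And>x. vec_nth x \<in> polydisc s \<Longrightarrow> f x = ps_eval F (vec_nth x)"
    and w: "vec_nth w \<in> polydisc s"
  shows "partial_deriv i f w = ps_eval (hasse (unit_index i) F) (vec_nth w)"
  unfolding partial_deriv_def
proof (rule tendsto_Lim[OF at_zero_nontrivial], unfold tendsto_absv, intro allI impI)
  fix e :: real assume "e > 0"
  have s: "0 < s j" for j by (rule polydisc_pos[OF w])
  have C: "0 \<le> C" by (rule coeff_bounded_nonneg[OF F])
  let ?c = "ps_eval (hasse (unit_index i) F) (vec_nth w)"
  define d where "d = min (s i) (e * (s i)\<^sup>2 / (C + 1))"
  have "d > 0" using s[of i] C \<open>e > 0\<close> by (simp add: d_def)
  have "absv ((f (w + axis i t) - f w) / t - ?c) < e" if t: "t \<noteq> 0" "absv t < d" for t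
  proof -
    have ti: "absv t < s i" using t by (simp add: d_def)
    have v: "vec_nth (axis i t) \<in> polydisc s" by (intro polydisc_axis s ti)
    have "vec_nth (w + axis i t) \<in> polydisc s"
      using polydisc_add[OF w v] by (simp add: plus_vec_def vec_lambda_inverse)
    moreover have "vec_nth (w + axis i t) = (\<lambda>j. w $ j + axis i t $ j)" by (simp add: fun_eq_iff)
    ultimately have fw: "f (w + axis i t) = ps_eval F (\<lambda>j. w $ j + axis i t $ j)"
      using f[of "w + axis i t"] by simp
    have ne: "0 \<noteq> unit_index i" by (auto simp: unit_index_def fun_eq_iff)
    have "absv (ps_eval F (\<lambda>j. w $ j + axis i t $ j) -
        (\<Sum>\<alpha>\<in>{0, unit_index i}. ps_eval (hasse \<alpha> F) (vec_nth w) * mpow (vec_nth (axis i t)) \<alpha>))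
        \<le> C * (absv t / s i)\<^sup>2"
      by (rule taylor_remainder_le[OF F w v])
         (use C mpow_axis_ratio_le[where s = s, OF s ti] in \<open>auto intro: mult_left_mono\<close>)
    then have le: "absv (f (w + axis i t) - f w - ?c * t) \<le> C * (absv t / s i)\<^sup>2"
      using ne fw f[OF w] by (simp add: axis_def algebra_simps)
    have "(f (w + axis i t) - f w) / t - ?c = (f (w + axis i t) - f w - ?c * t) / t"
      using t by (simp add: field_simps)
    moreover have "absv (y / t) * absv t = absv y" for y
      using t by (simp flip: absv_mult)
    ultimately have "absv ((f (w + axis i t) - f w) / t - ?c) * absv t \<le> (C * absv t / (s i)\<^sup>2) * absv t"
      using le by (simp add: power_divide power2_eq_square)
    moreover have "absv t > 0" using t absv_nonneg[of t] by (simp add: less_le del: absv_nonneg)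
    ultimately have "absv ((f (w + axis i t) - f w) / t - ?c) \<le> C * absv t / (s i)\<^sup>2"
      by (rule mult_right_le_imp_le)
    also have "\<dots> \<le> (C + 1) * absv t / (s i)\<^sup>2"
      by (intro divide_right_mono mult_right_mono) auto
    also have "\<dots> < (C + 1) * (e * (s i)\<^sup>2 / (C + 1)) / (s i)\<^sup>2"
      using t(2) C s[of i] by (intro divide_strict_right_mono mult_strict_left_mono) (auto simp: d_def)
    also have "\<dots> = e" using C s[of i] by simp
    finally show ?thesis .
  qed
  then show "\<forall>\<^sub>F t in at 0. absv ((f (w + axis i t) - f w) / t - ?c) < e"
    unfolding eventually_at using \<open>d > 0\<close> by (intro exI[of _ d]) (auto simp: dist_absv)
qed

lemma coeff_bounded_scale:
  assumes "coeff_bounded s C F" "absv c \<le> 1"  "\<And>i. 0 < s i"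
  shows "coeff_bounded s C (\<lambda>\<beta>. c * F \<beta>)"
  unfolding coeff_bounded_def
proof
  fix \<beta>
  have "absv (c * F \<beta>) * mpow s \<beta> \<le> absv (F \<beta>) * mpow s \<beta>"
    using assms by (intro mult_right_mono) (auto simp: absv_mult mult_left_le_one_le mpow_nonneg less_imp_le)
  also have "\<dots> \<le> C" using assms by (simp add: coeff_bounded_def)
  finally show "absv (c * F \<beta>) * mpow s \<beta> \<le> C" .
qed

definition factorial_index :: "('v::finite \<Rightarrow> nat) \<Rightarrow> nat" where
  "factorial_index \<alpha> = (\<Prod>i\<in>UNIV. fact (\<alpha> i))"

lemma binomial_shift:
  "(Suc b) * ((a + Suc b) choose a) = Suc a * ((a + Suc b) choose Suc a)"
  using binomial_absorb_comp[of "a + Suc b" a] binomial_absorption[of a "a + Suc b"] by simp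

text \<open>Both sides are the coefficients of \<open>D\<^sub>iD\<^sup>\<alpha>F\<close>. In direction \<open>i\<close> the equality of the integer factors is
  \<open>binomial_shift\<close>, in the other directions the factors coincide.\<close>

lemma hasse_unit_index_hasse:
  "hasse (unit_index i) (\<lambda>\<beta>. of_nat (factorial_index \<alpha>) * hasse \<alpha> F \<beta>) =
     (\<lambda>\<beta>. of_nat (factorial_index (unit_index i + \<alpha>)) * hasse (unit_index i + \<alpha>) F \<beta>)"
proof
  fix \<beta> :: "'a \<Rightarrow> nat"
  let ?e = "unit_index i"
  have j: "((?e j + \<beta> j) choose ?e j) * (fact (\<alpha> j) * ((\<alpha> j + (?e j + \<beta> j)) choose \<alpha> j)) =
        fact (?e j + \<alpha> j) * ((?e j + \<alpha> j + \<beta> j) choose (?e j + \<alpha> j))" for j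
    using binomial_shift[of "\<beta> j" "\<alpha> j"] by (cases "j = i") (simp_all add: unit_index_def algebra_simps)
  have "(\<Prod>j\<in>UNIV. (?e j + \<beta> j) choose ?e j) * (factorial_index \<alpha> * (\<Prod>j\<in>UNIV. (\<alpha> j + (?e j + \<beta> j)) choose \<alpha> j)) =
        factorial_index (?e + \<alpha>) * (\<Prod>j\<in>UNIV. (?e j + \<alpha> j + \<beta> j) choose (?e j + \<alpha> j))"
    unfolding factorial_index_def plus_fun_apply prod.distrib[symmetric] j ..
  then have "of_nat (\<Prod>j\<in>UNIV. (?e j + \<beta> j) choose ?e j) * (of_nat (factorial_index \<alpha>) * of_nat (\<Prod>j\<in>UNIV. (\<alpha> j + (?e j + \<beta> j)) choose \<alpha> j)) =
        (of_nat (factorial_index (?e + \<alpha>)) * of_nat (\<Prod>j\<in>UNIV. (?e j + \<alpha> j + \<beta> j) choose (?e j + \<alpha> j)) :: 'b)"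
    by (simp only: of_nat_mult[symmetric])
  moreover have "\<alpha> + (?e + \<beta>) = ?e + \<alpha> + \<beta>" by (simp add: ac_simps)
  ultimately show "hasse ?e (\<lambda>\<beta>. of_nat (factorial_index \<alpha>) * hasse \<alpha> F \<beta>) \<beta> =
      of_nat (factorial_index (?e + \<alpha>)) * hasse (?e + \<alpha>) F \<beta>"
    by (simp add: hasse_def mult.assoc[symmetric])
qed

lemma count_list_Cons: "count_list (i # ls) = unit_index i + count_list ls"
  by (auto simp: unit_index_def fun_eq_iff)

lemma count_list_Nil: "count_list [] = 0"
  by (simp add: fun_eq_iff)

lemma iterated_partial_deriv:
  fixes f :: "'k::complete_ultrametric_field ^ 'n::finite \<Rightarrow> 'k"
  assumes F: "coeff_bounded s C F"
    and f: "\<And>x. vec_nth x \<in> polydisc s \<Longrightarrow> f x = ps_eval F (vec_nth x)"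
    and w: "vec_nth w \<in> polydisc s"
  shows "foldr partial_deriv ls f w =
    of_nat (factorial_index (count_list ls)) * ps_eval (hasse (count_list ls) F) (vec_nth w)"
proof -
  have s: "0 < s j" for j by (rule polydisc_pos[OF w])
  define D where "D \<alpha> = (\<lambda>\<beta>. of_nat (factorial_index \<alpha>) * hasse \<alpha> F \<beta>)" for \<alpha>
  have D: "coeff_bounded s (C / mpow s \<alpha>) (D \<alpha>)" for \<alpha>
    unfolding D_def by (intro coeff_bounded_scale coeff_bounded_hasse F s absv_of_nat_le)
  have "foldr partial_deriv ls f x = ps_eval (D (count_list ls)) (vec_nth x)" if "vec_nth x \<in> polydisc s" for x
    using that
  proof (induction ls arbitrary: x)
    case Nil
    have "D 0 = F" unfolding D_def hasse_zero by (simp add: factorial_index_def)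
    then have "D (count_list []) = F" by (simp only: count_list_Nil)
    then show ?case using Nil by (simp only: f foldr.simps id_apply)
  next
    case (Cons i ls)
    have "D (count_list (i # ls)) = hasse (unit_index i) (D (count_list ls))"
      by (simp only: D_def hasse_unit_index_hasse count_list_Cons)
    then show ?case
      using partial_deriv_ps_eval[OF D Cons.IH Cons.prems] by (simp only: foldr.simps o_apply)
  qed
  moreover have "ps_eval (D \<alpha>) (vec_nth w) = of_nat (factorial_index \<alpha>) * ps_eval (hasse \<alpha> F) (vec_nth w)" for \<alpha>
    unfolding ps_eval_def D_def mult.assoc
    by (intro infsumI has_sum_cmult_right ps_eval_has_sum[OF coeff_bounded_hasse[OF F s] w, unfolded ps_eval_def])
  ultimately show ?thesis using w by simp
qed

section \<open>Functions given by bounded power series\<close>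

text \<open>The bound \<open>C\<close> is for the Gauss norm of the series and hence for the values as well. Keeping track
  of the series instead of the values is what makes the class closed under limits and compositions.\<close>

definition bounded_analytic ::
  "('v::finite \<Rightarrow> real) \<Rightarrow> real \<Rightarrow> (('v \<Rightarrow> 'k::complete_ultrametric_field) \<Rightarrow> 'k) \<Rightarrow> bool" where
  "bounded_analytic s C f \<longleftrightarrow> (\<exists>F. coeff_bounded s C F \<and> (\<forall>x\<in>polydisc s. f x = ps_eval F x))"

lemma bounded_analyticE:
  assumes "bounded_analytic s C f"
  obtains F where "coeff_bounded s C F" "\<And>x. x \<in> polydisc s \<Longrightarrow> f x = ps_eval F x"
  using assms by (auto simp: bounded_analytic_def)

lemma bounded_analytic_le: "bounded_analytic s C f \<Longrightarrow> x \<in> polydisc s \<Longrightarrow> absv (f x) \<le> C"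
  by (auto simp: bounded_analytic_def intro: absv_ps_eval_le)

lemma bounded_analytic_nonneg: "bounded_analytic s C f \<Longrightarrow> 0 \<le> C"
  by (auto simp: bounded_analytic_def intro: coeff_bounded_nonneg)

lemma bounded_analytic_mono: "bounded_analytic s C f \<Longrightarrow> C \<le> D \<Longrightarrow> bounded_analytic s D f"
  by (auto simp: bounded_analytic_def intro: coeff_bounded_mono)

lemma bounded_analytic_cong:
  "bounded_analytic s C f \<Longrightarrow> (\<And>x. x \<in> polydisc s \<Longrightarrow> g x = f x) \<Longrightarrow> bounded_analytic s C g"
  by (auto simp: bounded_analytic_def)

lemma ps_eval_single: "ps_eval (\<lambda>\<beta>. if \<beta> = \<alpha> then c else 0) x = c * mpow x \<alpha>"
  unfolding ps_eval_def by (intro infsumI has_sum_finite_neutralI[of "{\<alpha>}"]) auto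

lemma bounded_analytic_const:
  assumes "absv c \<le> C"
  shows "bounded_analytic s C (\<lambda>_. c)"
  unfolding bounded_analytic_def
  by (rule exI[of _ "\<lambda>\<beta>. if \<beta> = 0 then c else 0"])
     (use assms absv_nonneg[of c] in \<open>auto simp: coeff_bounded_def ps_eval_single simp del: absv_nonneg\<close>)

lemma bounded_analytic_coordinate:
  assumes "0 \<le> s i"
  shows "bounded_analytic s (s i) (\<lambda>x. x i)"
  unfolding bounded_analytic_def
  by (rule exI[of _ "\<lambda>\<beta>. if \<beta> = unit_index i then 1 else 0"])
     (use assms in \<open>auto simp: coeff_bounded_def ps_eval_single\<close>)

lemma bounded_analytic_add:
  assumes s: "\<And>i. 0 < s i" and f: "bounded_analytic s C f" and g: "bounded_analytic s C g"
  shows "bounded_analytic s C (\<lambda>x. f x + g x)"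
proof -
  obtain F G where F: "coeff_bounded s C F" "\<And>x. x \<in> polydisc s \<Longrightarrow> f x = ps_eval F x"
    and G: "coeff_bounded s C G" "\<And>x. x \<in> polydisc s \<Longrightarrow> g x = ps_eval G x"
    using f g by (auto elim!: bounded_analyticE)
  have "absv (F \<alpha> + G \<alpha>) * mpow s \<alpha> \<le> max (absv (F \<alpha>)) (absv (G \<alpha>)) * mpow s \<alpha>" for \<alpha>
    using s by (intro mult_right_mono absv_ultrametric mpow_nonneg less_imp_le)
  also have "\<dots> \<alpha> \<le> C" for \<alpha>
    using F(1) G(1) by (auto simp: coeff_bounded_def max_def)
  finally have "coeff_bounded s C (\<lambda>\<alpha>. F \<alpha> + G \<alpha>)" by (simp add: coeff_bounded_def)
  moreover have "f x + g x = ps_eval (\<lambda>\<alpha>. F \<alpha> + G \<alpha>) x" if x: "x \<in> polydisc s" for x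
    using infsumI[OF has_sum_add[OF ps_eval_has_sum[OF F(1) x] ps_eval_has_sum[OF G(1) x]]] F(2) G(2) x
    by (simp add: ps_eval_def algebra_simps)
  ultimately show ?thesis unfolding bounded_analytic_def by blast
qed

lemma bounded_analytic_sum:
  assumes s: "\<And>i. 0 < s i" and "0 \<le> C" and f: "\<And>a. a \<in> A \<Longrightarrow> bounded_analytic s C (f a)"
  shows "bounded_analytic s C (\<lambda>x. \<Sum>a\<in>A. f a x)"
  using f
proof (induction A rule: infinite_finite_induct)
  case (insert a A)
  then show ?case by (auto intro!: bounded_analytic_add s)
qed (use \<open>0 \<le> C\<close> in \<open>simp_all add: bounded_analytic_const\<close>)

lemma bounded_analytic_mult:
  assumes s: "\<And>i. 0 < s i" and f: "bounded_analytic s C f" and g: "bounded_analytic s D g"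
  shows "bounded_analytic s (C * D) (\<lambda>x. f x * g x)"
proof -
  obtain F G where F: "coeff_bounded s C F" "\<And>x. x \<in> polydisc s \<Longrightarrow> f x = ps_eval F x"
    and G: "coeff_bounded s D G" "\<And>x. x \<in> polydisc s \<Longrightarrow> g x = ps_eval G x"
    using f g by (auto elim!: bounded_analyticE)
  have CD: "0 \<le> C" "0 \<le> D" using f g bounded_analytic_nonneg by blast+
  define P where "P \<gamma> = (\<Sum>\<alpha>\<in>{..\<gamma>}. F \<alpha> * G (\<gamma> - \<alpha>))" for \<gamma>
  have "coeff_bounded s (C * D) P"
    unfolding coeff_bounded_def
  proof
    fix \<gamma>
    have "absv (F \<alpha> * G (\<gamma> - \<alpha>)) \<le> C * D / mpow s \<gamma>" if "\<alpha> \<in> {..\<gamma>}" for \<alpha>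
    proof -
      have "mpow s \<gamma> = mpow s \<alpha> * mpow s (\<gamma> - \<alpha>)"
        using that by (simp flip: mpow_add add: add_diff_multi_index)
      then have "absv (F \<alpha> * G (\<gamma> - \<alpha>)) * mpow s \<gamma> =
          (absv (F \<alpha>) * mpow s \<alpha>) * (absv (G (\<gamma> - \<alpha>)) * mpow s (\<gamma> - \<alpha>))"
        by (simp add: absv_mult mult_ac)
      also have "\<dots> \<le> C * D"
        using F(1) G(1) CD s
        by (intro mult_mono mult_nonneg_nonneg) (auto simp: coeff_bounded_def mpow_nonneg less_imp_le)
      finally show ?thesis using mpow_pos[of s \<gamma>] s by (simp add: pos_le_divide_eq)
    qed
    then have "absv (P \<gamma>) \<le> C * D / mpow s \<gamma>"
      unfolding P_def using CD s by (intro absv_sum_le) (auto simp: mpow_nonneg less_imp_le)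
    then show "absv (P \<gamma>) * mpow s \<gamma> \<le> C * D" using mpow_pos[of s \<gamma>] s by (simp add: pos_le_divide_eq)
  qed
  moreover have "f x * g x = ps_eval P x" if x: "x \<in> polydisc s" for x
  proof -
    define h where "h \<alpha> \<beta> = (F \<alpha> * mpow x \<alpha>) * (G \<beta> * mpow x \<beta>)" for \<alpha> \<beta>
    have rows: "(\<Sum>\<^sub>\<infinity>\<beta>. h \<alpha> \<beta>) = (F \<alpha> * mpow x \<alpha>) * g x" for \<alpha>
      unfolding h_def G(2)[OF x] by (intro infsumI has_sum_cmult_right ps_eval_has_sum[OF G(1) x])
    have "absv (h \<alpha> \<beta>) \<le> (C * mpow (radius_ratio s x) \<alpha>) * (D * mpow (radius_ratio s x) \<beta>)" for \<alpha> \<beta>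
      unfolding h_def absv_mult[of "F \<alpha> * mpow x \<alpha>"]
      by (intro mult_mono coeff_bounded_term_le[OF F(1) x] coeff_bounded_term_le[OF G(1) x]
          mult_nonneg_nonneg CD radius_ratio_nonneg x absv_nonneg)
    from has_sum_fibres[OF summable_on_cmult_right[OF summable_radius_ratio[OF x]]
        summable_on_cmult_right[OF summable_radius_ratio[OF x]] this
        mult_nonneg_nonneg[OF CD(1) radius_ratio_nonneg[OF x]] mult_nonneg_nonneg[OF CD(2) radius_ratio_nonneg[OF x]]
        finite_atMost_multi_index bij_antidiagonal]
    have "((\<lambda>\<gamma>. \<Sum>\<alpha>\<in>{..\<gamma>}. h \<alpha> (\<gamma> - \<alpha>)) has_sum (\<Sum>\<^sub>\<infinity>\<alpha>. (F \<alpha> * mpow x \<alpha>) * g x)) UNIV"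
      by (simp add: rows)
    also have "(\<Sum>\<^sub>\<infinity>\<alpha>. (F \<alpha> * mpow x \<alpha>) * g x) = f x * g x"
      unfolding F(2)[OF x] by (intro infsumI has_sum_cmult_left ps_eval_has_sum[OF F(1) x])
    also have "(\<lambda>\<gamma> :: 'a \<Rightarrow> nat. \<Sum>\<alpha>\<in>{..\<gamma>}. h \<alpha> (\<gamma> - \<alpha>)) = (\<lambda>\<gamma>. P \<gamma> * mpow x \<gamma>)"
      unfolding P_def h_def sum_distrib_right
    proof (intro ext sum.cong)
      fix \<gamma> \<alpha> :: "'a \<Rightarrow> nat" assume "\<alpha> \<in> {..\<gamma>}"
      then have "mpow x \<gamma> = mpow x \<alpha> * mpow x (\<gamma> - \<alpha>)"
        by (simp flip: mpow_add add: add_diff_multi_index)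
      then show "F \<alpha> * mpow x \<alpha> * (G (\<gamma> - \<alpha>) * mpow x (\<gamma> - \<alpha>)) = F \<alpha> * G (\<gamma> - \<alpha>) * mpow x \<gamma>"
        by (simp add: mult_ac)
    qed simp
    finally show ?thesis unfolding ps_eval_def by (rule infsumI[symmetric])
  qed
  ultimately show ?thesis unfolding bounded_analytic_def by blast
qed

text \<open>The series are summed coefficientwise.\<close>

lemma bounded_analytic_infsum:
  assumes s: "\<And>i. 0 < s i" and f: "\<And>a. bounded_analytic s (g a) (f a)"
    and g: "g summable_on UNIV" and B: "\<And>a. g a \<le> B" "0 \<le> B"
  shows "bounded_analytic s B (\<lambda>x. \<Sum>\<^sub>\<infinity>a. f a x)"
proof -
  obtain F where F: "\<And>a. coeff_bounded s (g a) (F a)" "\<And>a x. x \<in> polydisc s \<Longrightarrow> f a x = ps_eval (F a) x"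
    using f unfolding bounded_analytic_def by metis
  have nn: "0 \<le> g a" for a using f by (rule bounded_analytic_nonneg)
  define P where "P \<alpha> = (\<Sum>\<^sub>\<infinity>a. F a \<alpha>)" for \<alpha>
  have le: "absv (F a \<alpha>) \<le> g a * (1 / mpow s \<alpha>)" for a \<alpha>
    using F(1)[of a] mpow_pos[of s \<alpha>] s by (simp add: coeff_bounded_def pos_le_divide_eq)
  have sm: "(\<lambda>a. F a \<alpha>) summable_on UNIV" for \<alpha>
    by (rule summable_on_dominated[OF summable_on_cmult_left[OF g]]) (rule le)
  have "coeff_bounded s B P"
    unfolding coeff_bounded_def
  proof
    fix \<alpha>
    have "absv (P \<alpha>) \<le> B * (1 / mpow s \<alpha>)"
      unfolding P_def using s B
      by (intro absv_infsum_le order_trans[OF le] mult_right_mono) (auto simp: mpow_nonneg less_imp_le)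
    then show "absv (P \<alpha>) * mpow s \<alpha> \<le> B" using mpow_pos[of s \<alpha>] s by (simp add: pos_le_divide_eq)
  qed
  moreover have "(\<Sum>\<^sub>\<infinity>a. f a x) = ps_eval P x" if x: "x \<in> polydisc s" for x
  proof -
    have "(\<Sum>\<^sub>\<infinity>a. f a x) = (\<Sum>\<^sub>\<infinity>a. \<Sum>\<^sub>\<infinity>\<alpha>. F a \<alpha> * mpow x \<alpha>)"
      using F(2)[OF x] by (simp add: ps_eval_def)
    also have "\<dots> = (\<Sum>\<^sub>\<infinity>\<alpha>. \<Sum>\<^sub>\<infinity>a. F a \<alpha> * mpow x \<alpha>)"
      by (rule infsum_swap_dominated[OF g summable_radius_ratio[OF x] coeff_bounded_term_le[OF F(1) x]
            nn radius_ratio_nonneg[OF x]])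
    also have "\<dots> = ps_eval P x"
      unfolding ps_eval_def P_def using infsum_cmult_left[OF sm] by simp
    finally show ?thesis .
  qed
  ultimately show ?thesis unfolding bounded_analytic_def by blast
qed

lemma bounded_analytic_power:
  assumes "\<And>i. 0 < s i" "bounded_analytic s C f"
  shows "bounded_analytic s (C ^ n) (\<lambda>x. f x ^ n)"
  by (induction n) (auto intro!: bounded_analytic_mult bounded_analytic_const assms)

lemma bounded_analytic_prod:
  assumes s: "\<And>i. 0 < s i" and f: "\<And>a. a \<in> A \<Longrightarrow> bounded_analytic s (C a) (f a)"
  shows "bounded_analytic s (\<Prod>a\<in>A. C a) (\<lambda>x. \<Prod>a\<in>A. f a x)"
  using f
  by (induction A rule: infinite_finite_induct)
     (auto intro!: bounded_analytic_mult bounded_analytic_const s)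

lemma bounded_analytic_mpow:
  assumes "\<And>i. 0 < s i" "\<And>a. bounded_analytic s (C a) (\<lambda>x. f x a)"
  shows "bounded_analytic s (mpow C \<alpha>) (\<lambda>x. mpow (f x) \<alpha>)"
  unfolding mpow_def by (intro bounded_analytic_prod bounded_analytic_power assms)

text \<open>The strict inequality makes the family of terms of \<open>F\<close>, with the functions \<open>f\<close> substituted,
  geometrically summable in Gauss norm.\<close>

lemma bounded_analytic_compose:
  assumes s: "\<And>i. 0 < s i" and F: "coeff_bounded t C F"
    and f: "\<And>a. bounded_analytic s (d a) (\<lambda>x. f x a)" and lt: "\<And>a. d a < t a"
  shows "bounded_analytic s C (\<lambda>x. ps_eval F (f x))"
  unfolding ps_eval_def
proof (rule bounded_analytic_infsum[OF s])
  have d: "0 \<le> d a" for a by (rule bounded_analytic_nonneg[OF f])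
  then have t: "0 < t a" for a using lt[of a] by (rule le_less_trans)
  have C: "0 \<le> C" by (rule coeff_bounded_nonneg[OF F])
  let ?q = "\<lambda>a. d a / t a"
  show "bounded_analytic s (C * mpow ?q \<alpha>) (\<lambda>x. F \<alpha> * mpow (f x) \<alpha>)" for \<alpha>
  proof (rule bounded_analytic_mono)
    show "bounded_analytic s (absv (F \<alpha>) * mpow d \<alpha>) (\<lambda>x. F \<alpha> * mpow (f x) \<alpha>)"
      by (intro bounded_analytic_mult bounded_analytic_const bounded_analytic_mpow f s order_refl)
    have "absv (F \<alpha>) * mpow d \<alpha> = absv (F \<alpha>) * mpow t \<alpha> * mpow ?q \<alpha>"
      using mpow_pos[of t \<alpha>] t by (simp add: mpow_divide)
    also have "\<dots> \<le> C * mpow ?q \<alpha>"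
      using F d t by (intro mult_right_mono mpow_nonneg) (auto simp: coeff_bounded_def less_imp_le)
    finally show "absv (F \<alpha>) * mpow d \<alpha> \<le> C * mpow ?q \<alpha>" .
  qed
  show "(\<lambda>\<alpha>. C * mpow ?q \<alpha>) summable_on UNIV"
    using d t lt by (intro summable_on_cmult_right summable_on_mpow) (auto simp: less_imp_le)
  have "mpow ?q \<alpha> \<le> mpow (\<lambda>_. 1) \<alpha>" for \<alpha>
    using d t lt by (intro mpow_mono) (auto simp: less_imp_le)
  then show "C * mpow ?q \<alpha> \<le> C" for \<alpha>
    using C mult_left_mono[of "mpow ?q \<alpha>" 1 C] by (simp add: mpow_const)
  show "0 \<le> C" by (rule C)
qed

section \<open>Generating functions of ordered forests\<close>

definition forests :: "nat \<Rightarrow> otree list set" where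
  "forests m = {ts. sum_list (map node_count ts) = m}"

lemma trees_Suc: "trees (Suc m) = Node ` forests m"
proof -
  have "\<theta> \<in> Node ` forests m" if "\<theta> \<in> trees (Suc m)" for \<theta>
    using that by (cases \<theta>) (auto simp: trees_def forests_def)
  then show ?thesis by (auto simp: trees_def forests_def)
qed

lemma node_count_pos: "0 < node_count \<theta>"
  by (cases \<theta>) simp

lemma trees_0: "trees 0 = {}"
  using node_count_pos by (auto simp: trees_def)

lemma length_le_forest: "ts \<in> forests m \<Longrightarrow> length ts \<le> m"
proof -
  have "length ts \<le> sum_list (map node_count ts)"
  proof (induction ts)
    case (Cons \<theta> ts)
    then show ?case using node_count_pos[of \<theta>] by simp
  qed simp
  then show "ts \<in> forests m \<Longrightarrow> length ts \<le> m" by (simp add: forests_def)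
qed

lemma finite_forests: "finite (forests m)"
  using finite_trees[of "Suc m"] unfolding trees_Suc by (rule finite_imageD) (auto simp: inj_on_def)

text \<open>The weight of a forest of prescribed length is a product over its trees and the number of nodes is
  additive, so splitting off the first tree corresponds to a factor of the generating function.\<close>

lemma sum_forests_eq_fps_nth:
  fixes val :: "otree \<Rightarrow> 'n \<Rightarrow> 'a::comm_ring_1"
  defines "h \<equiv> \<lambda>l. Abs_fps (\<lambda>N. \<Sum>\<theta>\<in>trees N. val \<theta> l)"
  shows "(\<Sum>ts | ts \<in> forests m \<and> length ts = length ls. \<Prod>s<length ls. val (ts ! s) (ls ! s)) =
           fps_nth (prod_list (map h ls)) m"
proof (induction ls arbitrary: m)
  case Nil
  have "{ts. ts \<in> forests m \<and> length ts = length []} = (if m = 0 then {[]} else {})"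
    by (auto simp: forests_def)
  then show ?case by simp
next
  case (Cons l ls)
  let ?F = "\<lambda>k. {ts. ts \<in> forests k \<and> length ts = length ls}"
  let ?p = "\<lambda>ts. \<Prod>s<length ls. val (ts ! s) (ls ! s)"
  have fin: "finite (?F k)" for k using finite_forests[of k] by simp
  have "fps_nth (prod_list (map h (l # ls))) m = (\<Sum>k=0..m. (\<Sum>\<theta>\<in>trees k. val \<theta> l) * sum ?p (?F (m - k)))"
    by (simp add: fps_mult_nth Cons.IH h_def)
  also have "\<dots> = (\<Sum>k=0..m. \<Sum>(\<theta>, ts)\<in>trees k \<times> ?F (m - k). val \<theta> l * ?p ts)"
    by (simp add: sum_product sum.cartesian_product)
  also have "\<dots> = (\<Sum>(k, \<theta>, ts)\<in>(SIGMA k:{0..m}. trees k \<times> ?F (m - k)). val \<theta> l * ?p ts)"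
    using fin finite_trees by (subst sum.Sigma) auto
  also have "\<dots> = (\<Sum>ts | ts \<in> forests m \<and> length ts = length (l # ls).
      \<Prod>s<length (l # ls). val (ts ! s) ((l # ls) ! s))"
  proof (rule sum.reindex_bij_witness[where j = "\<lambda>(k, \<theta>, ts). \<theta> # ts"
        and i = "\<lambda>ts. (node_count (hd ts), hd ts, tl ts)"], goal_cases)
    case (4 ts)
    then show ?case by (cases ts) (auto simp: forests_def trees_def)
  next
    case (3 ts)
    then show ?case by (cases ts) (auto simp: forests_def trees_def)
  qed (auto simp: forests_def trees_def prod.lessThan_Suc_shift simp del: prod.lessThan_Suc)
  finally show ?case ..
qed

text \<open>The case distinction in the definition of the value disappears: the differential of order 0 is the
  matrix itself, and \<open>0! = 1\<close>.\<close>

lemma tree_val_Node_nth: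
  "tree_val A u w (Node ts) $ i =
     (\<Sum>j\<in>UNIV. (\<Sum>ls | length ls = length ts. 1 / fact (length ls) *
        foldr partial_deriv ls (\<lambda>x. A x $ i $ j) w *
        (\<Prod>s<length ls. tree_val A u w (ts ! s) $ (ls ! s))) * u $ j)"
proof -
  have "A w = matrix_differential A w []"
    by (simp add: matrix_differential_def vec_eq_iff)
  then have "tree_val A u w (Node ts) =
      (1 / fact (length ts)) *s (matrix_differential A w (map (tree_val A u w) ts) *v u)"
    by simp
  then have "tree_val A u w (Node ts) $ i = (\<Sum>j\<in>UNIV. 1 / fact (length ts) *
      ((\<Sum>ls | length ls = length ts. foldr partial_deriv ls (\<lambda>x. A x $ i $ j) w *
        (\<Prod>s<length ts. map (tree_val A u w) ts ! s $ (ls ! s))) * u $ j))"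
    by (simp add: matrix_differential_def matrix_vector_mult_def sum_distrib_left del: tree_val.simps)
  also have "\<dots> = (\<Sum>j\<in>UNIV. (\<Sum>ls | length ls = length ts. 1 / fact (length ls) *
        foldr partial_deriv ls (\<lambda>x. A x $ i $ j) w *
        (\<Prod>s<length ls. tree_val A u w (ts ! s) $ (ls ! s))) * u $ j)"
    by (intro sum.cong refl)
       (auto simp: sum_distrib_left sum_distrib_right mult.assoc intro!: sum.cong prod.cong)
  finally show ?thesis .
qed

lemma finite_lists_length_atMost: "finite {ls :: 'n::finite list. length ls \<le> m}"
  using finite_lists_length_le[of "UNIV :: 'n set" m] by simp

lemma tree_term_Suc_nth:
  fixes A :: "'k::complete_ultrametric_field ^ 'n::finite \<Rightarrow> 'k ^ 'l::finite ^ 'n"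
  defines "h \<equiv> \<lambda>u w l. Abs_fps (\<lambda>N. tree_term A u w N $ l)"
  shows "tree_term A u w (Suc m) $ i =
     (\<Sum>j\<in>UNIV. (\<Sum>ls | length ls \<le> m. 1 / fact (length ls) * foldr partial_deriv ls (\<lambda>x. A x $ i $ j) w *
        fps_nth (prod_list (map (h u w) ls)) m) * u $ j)"
proof -
  let ?B = "{ls :: 'n list. length ls \<le> m}"
  let ?d = "\<lambda>j ls. 1 / fact (length ls) * foldr partial_deriv ls (\<lambda>x. A x $ i $ j) w"
  let ?p = "\<lambda>ts ls. \<Prod>s<length ls. tree_val A u w (ts ! s) $ (ls ! s)"
  have h: "h u w = (\<lambda>l. Abs_fps (\<lambda>N. \<Sum>\<theta>\<in>trees N. tree_val A u w \<theta> $ l))"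
    by (simp add: h_def tree_term_def)
  have "tree_term A u w (Suc m) $ i = (\<Sum>ts\<in>forests m. tree_val A u w (Node ts) $ i)"
    unfolding tree_term_def trees_Suc by (subst sum.reindex) (auto simp: inj_on_def)
  also have "\<dots> = (\<Sum>ts\<in>forests m. \<Sum>j\<in>UNIV. \<Sum>ls | ls \<in> ?B \<and> length ts = length ls. ?d j ls * ?p ts ls * u $ j)"
    unfolding tree_val_Node_nth sum_distrib_right
    by (intro sum.cong refl) (auto dest: length_le_forest)
  also have "\<dots> = (\<Sum>j\<in>UNIV. \<Sum>ts\<in>forests m. \<Sum>ls | ls \<in> ?B \<and> length ts = length ls. ?d j ls * ?p ts ls * u $ j)"
    by (rule sum.swap)
  also have "\<dots> = (\<Sum>j\<in>UNIV. \<Sum>ls\<in>?B. \<Sum>ts | ts \<in> forests m \<and> length ts = length ls. ?d j ls * ?p ts ls * u $ j)"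
    by (intro sum.cong refl sum.swap_restrict finite_forests finite_lists_length_atMost)
  also have "\<dots> = (\<Sum>j\<in>UNIV. (\<Sum>ls\<in>?B. ?d j ls * fps_nth (prod_list (map (h u w) ls)) m) * u $ j)"
    unfolding h sum_forests_eq_fps_nth[symmetric]
    by (simp add: sum_distrib_left sum_distrib_right)
  finally show ?thesis by simp
qed

lemma length_eq_degree_of: "length ls = degree_of (count_list ls)" for ls :: "'n::finite list"
  unfolding degree_of_def by (rule sum_count_set[symmetric]) auto

text \<open>The lists with prescribed multiplicities are the orderings of a multiset.\<close>

lemma card_count_list_eq:
  fixes \<alpha> :: "'n::finite \<Rightarrow> nat"
  shows "card {ls. count_list ls = \<alpha>} * factorial_index \<alpha> = fact (degree_of \<alpha>)"
proof -
  define A where "A = (\<Sum>i\<in>UNIV. replicate_mset (\<alpha> i) i)"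
  have count: "count A = \<alpha>"
    by (rule ext) (simp add: A_def count_sum)
  have "{ls. count_list ls = \<alpha>} = permutations_of_multiset A"
    unfolding permutations_of_multiset_def multiset_eq_iff count count_mset by (auto simp: fun_eq_iff)
  moreover have "factorial_index \<alpha> = (\<Prod>x\<in>set_mset A. fact (count A x))"
    unfolding factorial_index_def count
    by (rule prod.mono_neutral_right) (auto simp: count not_in_iff simp flip: count)
  moreover have "degree_of \<alpha> = size A"
    unfolding degree_of_def A_def by simp
  ultimately show ?thesis using card_permutations_of_multiset_aux[of A] by simp
qed

lemma finite_degree_le: "finite {\<alpha> :: 'n::finite \<Rightarrow> nat. degree_of \<alpha> \<le> m}"
proof (rule finite_subset)
  show "{\<alpha> :: 'n \<Rightarrow> nat. degree_of \<alpha> \<le> m} \<subseteq> {..\<lambda>_. m}"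
  proof
    fix \<alpha> :: "'n \<Rightarrow> nat" assume "\<alpha> \<in> {\<alpha>. degree_of \<alpha> \<le> m}"
    moreover have "\<alpha> i \<le> degree_of \<alpha>" for i
      unfolding degree_of_def by (rule member_le_sum) auto
    ultimately show "\<alpha> \<in> {..\<lambda>_. m}" by (auto simp: le_fun_def intro: order_trans)
  qed
qed simp

text \<open>Here the factor \<open>1 / t!\<close> of the tree values cancels: there are \<open>t! / \<alpha>!\<close> lists of length \<open>t\<close> with
  multiplicities \<open>\<alpha>\<close>, and the derivative along each of them is \<open>\<alpha>!\<close> times a divided derivative.\<close>

lemma sum_lists_eq_sum_multi_indices:
  fixes \<Phi> :: "('n::finite \<Rightarrow> nat) \<Rightarrow> 'a::field_char_0"
  shows "(\<Sum>ls | length ls \<le> m. of_nat (factorial_index (count_list ls)) / fact (length ls) * \<Phi> (count_list ls)) =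
    (\<Sum>\<alpha> | degree_of \<alpha> \<le> m. \<Phi> \<alpha>)"
proof -
  let ?t = "\<lambda>ls :: 'n list. of_nat (factorial_index (count_list ls)) / fact (length ls) * \<Phi> (count_list ls)"
  have "(\<Sum>ls | length ls \<le> m. ?t ls) =
      (\<Sum>\<alpha> | degree_of \<alpha> \<le> m. \<Sum>ls | ls \<in> {ls. length ls \<le> m} \<and> count_list ls = \<alpha>. ?t ls)"
    by (rule sum.group[OF finite_lists_length_atMost finite_degree_le, symmetric])
       (auto simp: length_eq_degree_of)
  also have "\<dots> = (\<Sum>\<alpha> | degree_of \<alpha> \<le> m. \<Phi> \<alpha>)"
  proof (rule sum.cong)
    fix \<alpha> :: "'n \<Rightarrow> nat" assume \<alpha>: "\<alpha> \<in> {\<alpha>. degree_of \<alpha> \<le> m}"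
    then have "{ls. ls \<in> {ls. length ls \<le> m} \<and> count_list ls = \<alpha>} = {ls. count_list ls = \<alpha>}"
      by (auto simp: length_eq_degree_of)
    then have "(\<Sum>ls | ls \<in> {ls. length ls \<le> m} \<and> count_list ls = \<alpha>. ?t ls) =
        (\<Sum>ls | count_list ls = \<alpha>. of_nat (factorial_index \<alpha>) / fact (degree_of \<alpha>) * \<Phi> \<alpha>)"
      by (intro sum.cong) (auto simp: length_eq_degree_of)
    also have "\<dots> = of_nat (card {ls. count_list ls = \<alpha>} * factorial_index \<alpha>) / fact (degree_of \<alpha>) * \<Phi> \<alpha>"
      by simp
    also have "\<dots> = \<Phi> \<alpha>" unfolding card_count_list_eq by simp
    finally show "(\<Sum>ls | ls \<in> {ls. length ls \<le> m} \<and> count_list ls = \<alpha>. ?t ls) = \<Phi> \<alpha>" .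
  qed simp
  finally show ?thesis .
qed

lemma prod_list_eq_mpow: "prod_list (map h ls) = mpow h (count_list ls)"
  by (induction ls) (simp_all only: list.map prod_list.Nil prod_list.Cons count_list_Nil mpow_zero
      count_list_Cons mpow_add mpow_unit_index)

text \<open>The generating function of the tree sums with one factor \<open>X\<close> removed. The product of the full
  generating functions with exponents \<open>\<alpha>\<close> is then visibly divisible by \<open>X\<^bsup>|\<alpha>|\<^esup>\<close>. This makes
  the sum in the recursion finite, and later supplies the decay in \<open>\<alpha>\<close> that is needed to
  exchange summations.\<close>

definition tree_fps ::
  "('k::complete_ultrametric_field ^ 'n::finite \<Rightarrow> 'k ^ 'l::finite ^ 'n) \<Rightarrow> 'k ^ 'l \<Rightarrow> 'k ^ 'n \<Rightarrow> 'n \<Rightarrow> 'k fps" where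
  "tree_fps A u w l = Abs_fps (\<lambda>m. tree_term A u w (Suc m) $ l)"

text \<open>Cutting off the root gives a forest. Collecting the ordered forests by the multiplicities \<open>\<alpha>\<close>
  of the coordinates that they are contracted with leaves a sum over multi-indices in which no factorial
  remains; \<open>c j \<alpha>\<close> stands for the divided derivative.\<close>

lemma tree_term_recursion:
  fixes A :: "'k::complete_ultrametric_field ^ 'n::finite \<Rightarrow> 'k ^ 'l::finite ^ 'n"
  assumes deriv: "\<And>j ls. foldr partial_deriv ls (\<lambda>x. A x $ i $ j) w =
      of_nat (factorial_index (count_list ls)) * c j (count_list ls)"
  shows "tree_term A u w (Suc m) $ i =
    (\<Sum>j\<in>UNIV. (\<Sum>\<alpha> | degree_of \<alpha> \<le> m. c j \<alpha> *
        fps_nth (mpow (tree_fps A u w) \<alpha>) (m - degree_of \<alpha>)) * u $ j)"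
proof -
  let ?h = "\<lambda>l. Abs_fps (\<lambda>N. tree_term A u w N $ l)"
  have "?h l = fps_X * tree_fps A u w l" for l
    by (rule fps_ext) (auto simp: tree_fps_def tree_term_def trees_0 fps_X_mult_nth)
  then have h: "?h = (\<lambda>l. fps_X * tree_fps A u w l)" by (rule ext)
  have "(\<Sum>ls | length ls \<le> m. 1 / fact (length ls) * foldr partial_deriv ls (\<lambda>x. A x $ i $ j) w *
        fps_nth (prod_list (map ?h ls)) m) =
      (\<Sum>\<alpha> | degree_of \<alpha> \<le> m. c j \<alpha> * fps_nth (mpow ?h \<alpha>) m)" for j
    unfolding sum_lists_eq_sum_multi_indices[symmetric] deriv prod_list_eq_mpow
    by (simp add: mult.assoc)
  also have "\<dots> j = (\<Sum>\<alpha> | degree_of \<alpha> \<le> m. c j \<alpha> *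
        fps_nth (mpow (tree_fps A u w) \<alpha>) (m - degree_of \<alpha>))" for j
    unfolding h mpow_mult mpow_const
    by (intro sum.cong) (auto simp: fps_X_power_mult_nth)
  finally show ?thesis unfolding tree_term_Suc_nth by simp
qed

section \<open>Geometrically bounded formal power series\<close>

text \<open>The bound \<open>a q\<^sup>k\<close> is multiplicative. Only coefficients up to \<open>K\<close> are considered, because in the
  induction on the size of trees nothing is known yet about later ones.\<close>

lemma bounded_analytic_fps_mult:
  assumes s: "\<And>i. 0 < s i"
    and A: "\<And>k. k \<le> K \<Longrightarrow> bounded_analytic s (a * q ^ k) (\<lambda>x. fps_nth (A x) k)"
    and B: "\<And>k. k \<le> K \<Longrightarrow> bounded_analytic s (b * q ^ k) (\<lambda>x. fps_nth (B x) k)"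
    and k: "k \<le> K"
  shows "bounded_analytic s (a * b * q ^ k) (\<lambda>x. fps_nth (A x * B x) k)"
proof -
  have "bounded_analytic s (a * b * q ^ k) (\<lambda>x. fps_nth (A x) i * fps_nth (B x) (k - i))" if "i \<in> {0..k}" for i
  proof -
    have "q ^ k = q ^ i * q ^ (k - i)"
      using that by (simp flip: power_add)
    then have e: "a * b * q ^ k = (a * q ^ i) * (b * q ^ (k - i))"
      by (simp only: mult_ac)
    show ?thesis
      unfolding e using that k by (intro bounded_analytic_mult s A B) auto
  qed
  moreover from this[of 0] have "0 \<le> a * b * q ^ k" by (auto intro: bounded_analytic_nonneg)
  ultimately show ?thesis
    unfolding fps_mult_nth by (intro bounded_analytic_sum s) auto
qed

lemma bounded_analytic_fps_mpow:
  fixes g :: "('v::finite \<Rightarrow> 'k::complete_ultrametric_field) \<Rightarrow> 'n::finite \<Rightarrow> 'k fps"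
  assumes s: "\<And>i. 0 < s i" and q: "0 \<le> q"
    and g: "\<And>l k. k \<le> K \<Longrightarrow> bounded_analytic s (a * q ^ k) (\<lambda>x. fps_nth (g x l) k)"
    and k: "k \<le> K"
  shows "bounded_analytic s (a ^ degree_of \<alpha> * q ^ k) (\<lambda>x. fps_nth (mpow (g x) \<alpha>) k)"
proof -
  have one: "bounded_analytic s (1 * q ^ k) (\<lambda>x. fps_nth (1 :: 'k fps) k)" for k
    using q by (intro bounded_analytic_const) auto
  have pow: "bounded_analytic s (a ^ n * q ^ k) (\<lambda>x. fps_nth (g x l ^ n) k)" if "k \<le> K" for n l k
    using that
  proof (induction n arbitrary: k)
    case 0
    then show ?case using one[of k] by simp
  next
    case (Suc n)
    then show ?case unfolding power_Suc by (intro bounded_analytic_fps_mult[where K = K] s g)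
  qed
  have "bounded_analytic s ((\<Prod>l\<in>L. a ^ \<alpha> l) * q ^ k) (\<lambda>x. fps_nth (\<Prod>l\<in>L. g x l ^ \<alpha> l) k)"
    if "finite L" "k \<le> K" for L k
    using that
  proof (induction L arbitrary: k rule: finite_induct)
    case empty
    then show ?case using one[of k] by simp
  next
    case (insert l L)
    then show ?case
      unfolding prod.insert[OF insert.hyps] by (intro bounded_analytic_fps_mult[where K = K] s pow)
  qed
  from this[OF finite[of UNIV] k] show ?thesis by (simp add: mpow_def degree_of_def power_sum)
qed

text \<open>The value of \<open>A\<close> at 1, for coefficients that decay geometrically; \<open>a\<close> is a multiplicative
  bound.\<close>

definition fps_value :: "real \<Rightarrow> real \<Rightarrow> 'k::complete_ultrametric_field fps \<Rightarrow> 'k \<Rightarrow> bool" where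
  "fps_value q a A x \<longleftrightarrow> (\<forall>k. absv (fps_nth A k) \<le> a * q ^ k) \<and> (fps_nth A has_sum x) UNIV"

lemma summable_geometric_nat: "0 \<le> q \<Longrightarrow> q < 1 \<Longrightarrow> (\<lambda>k. q ^ k :: real) summable_on UNIV"
  by (subst summable_on_UNIV_nonneg_real_iff) (auto simp: summable_geometric)

lemma fps_value_mult:
  assumes q: "0 \<le> q" "q < 1" and A: "fps_value q a A x" and B: "fps_value q b B y"
  shows "fps_value q (a * b) (A * B) (x * y)"
proof -
  have a: "0 \<le> a" "0 \<le> b"
    using A B absv_nonneg[of "fps_nth A 0"] absv_nonneg[of "fps_nth B 0"]
    by (auto simp: fps_value_def simp del: absv_nonneg dest!: spec[of _ 0])
  have le: "absv (fps_nth A i * fps_nth B j) \<le> (a * q ^ i) * (b * q ^ j)" for i j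
    using A B a q unfolding absv_mult fps_value_def by (intro mult_mono) auto
  have "absv (fps_nth (A * B) k) \<le> a * b * q ^ k" for k
    unfolding fps_mult_nth
  proof (rule absv_sum_le)
    fix i assume "i \<in> {0..k}"
    then have "q ^ k = q ^ i * q ^ (k - i)"
      by (simp flip: power_add)
    then have e: "a * b * q ^ k = (a * q ^ i) * (b * q ^ (k - i))"
      by (simp only: mult_ac)
    show "absv (fps_nth A i * fps_nth B (k - i)) \<le> a * b * q ^ k" unfolding e by (rule le)
  qed (use a q in auto)
  moreover have "(fps_nth (A * B) has_sum x * y) UNIV"
  proof -
    have row: "(\<Sum>\<^sub>\<infinity>j. fps_nth A i * fps_nth B j) = fps_nth A i * y" for i
      using B by (intro infsumI has_sum_cmult_right) (simp add: fps_value_def)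
    have "(\<Sum>\<^sub>\<infinity>i. \<Sum>\<^sub>\<infinity>j. fps_nth A i * fps_nth B j) = x * y"
      unfolding row using A by (intro infsumI has_sum_cmult_left) (simp add: fps_value_def)
    moreover have "fps_nth (A * B) = (\<lambda>k. \<Sum>i\<in>{..k}. fps_nth A i * fps_nth B (k - i))"
      by (simp add: fun_eq_iff fps_mult_nth atMost_atLeast0)
    ultimately show ?thesis
      using has_sum_fibres[OF summable_on_cmult_right[OF summable_geometric_nat[OF q]]
        summable_on_cmult_right[OF summable_geometric_nat[OF q]] le _ _ finite_atMost bij_antidiagonal_nat] a q
      by simp
  qed
  ultimately show ?thesis by (simp add: fps_value_def)
qed

lemma fps_value_mpow:
  fixes g :: "'n::finite \<Rightarrow> 'k::complete_ultrametric_field fps"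
  assumes q: "0 \<le> q" "q < 1" and g: "\<And>l. fps_value q a (g l) (v l)"
  shows "fps_value q (a ^ degree_of \<alpha>) (mpow g \<alpha>) (mpow v \<alpha>)"
proof -
  have one: "fps_value q 1 1 1"
    using q unfolding fps_value_def by (auto intro!: has_sum_finite_neutralI[of "{0}"] split: if_splits)
  have pow: "fps_value q (a ^ n) (g l ^ n) (v l ^ n)" for l n
    by (induction n) (auto intro: one fps_value_mult q g)
  have "fps_value q (\<Prod>l\<in>L. a ^ \<alpha> l) (\<Prod>l\<in>L. g l ^ \<alpha> l) (\<Prod>l\<in>L. v l ^ \<alpha> l)" for L
    by (induction L rule: infinite_finite_induct) (auto intro: one fps_value_mult q pow)
  then show ?thesis by (simp add: mpow_def degree_of_def power_sum)
qed

section \<open>Sup-norms and vector-valued sums\<close>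

lemma supnorm_le_iff: "supnorm x \<le> B \<longleftrightarrow> (\<forall>i. absv (x $ i) \<le> B)"
  unfolding supnorm_def by (subst Max_le_iff) auto

lemma supnorm_less_iff: "supnorm x < B \<longleftrightarrow> (\<forall>i. absv (x $ i) < B)"
  unfolding supnorm_def by (subst Max_less_iff) auto

lemma absv_nth_le_supnorm: "absv (x $ i) \<le> supnorm x"
  using supnorm_le_iff[of x "supnorm x"] by simp

lemma supnorm_nonneg: "0 \<le> supnorm x"
  using absv_nth_le_supnorm order_trans[OF absv_nonneg] by blast

lemma in_oball_0_iff: "x \<in> oball 0 \<rho> \<longleftrightarrow> vec_nth x \<in> polydisc (\<lambda>_. \<rho>)"
  by (simp add: oball_def supnorm_less_iff polydisc_def)

lemma has_sum_vecI:
  assumes "\<And>i. ((\<lambda>a. f a $ i) has_sum s $ i) A"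
  shows "(f has_sum s) A"
proof -
  have "((\<lambda>F. sum f F $ i) \<longlongrightarrow> s $ i) (finite_subsets_at_top A)" for i
    using assms[of i] by (simp add: has_sum_def)
  then show ?thesis unfolding has_sum_def by (rule vec_tendstoI)
qed

lemma has_sum_sum:
  fixes f :: "'b \<Rightarrow> 'a \<Rightarrow> 'c::topological_comm_monoid_add"
  assumes "\<And>j. j \<in> J \<Longrightarrow> (f j has_sum s j) A"
  shows "((\<lambda>a. \<Sum>j\<in>J. f j a) has_sum (\<Sum>j\<in>J. s j)) A"
  using assms by (induction J rule: infinite_finite_induct) (auto intro: has_sum_add)

lemma pseries_eval_eqI:
  assumes "\<And>j. ((\<lambda>\<alpha>. F \<alpha> $ j * mpow (vec_nth x) \<alpha>) has_sum s $ j) UNIV"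
  shows "pseries_eval F x = s"
  unfolding pseries_eval_def
  by (intro infsumI has_sum_vecI) (use assms in \<open>simp add: mpow_def mult.commute\<close>)

text \<open>A bounded series on a polydisc can be re-expanded about every point of the polydisc, without
  loss of radius.\<close>

lemma bounded_analytic_expansion:
  fixes f :: "'k::complete_ultrametric_field ^ 'v::finite \<Rightarrow> 'k ^ 'm::finite"
  assumes f: "\<And>i. bounded_analytic s C (\<lambda>z. f (vec_lambda z) $ i)"
    and x: "vec_nth x \<in> polydisc s" and \<rho>: "0 < \<rho>" "\<And>a. \<rho> \<le> s a"
  shows "\<exists>F. converges_oball F \<rho> \<and> (\<forall>y\<in>oball 0 \<rho>. f (x + y) = pseries_eval F y)"
proof -
  obtain F where F: "\<And>i. coeff_bounded s C (F i)"
      "\<And>i z. z \<in> polydisc s \<Longrightarrow> f (vec_lambda z) $ i = ps_eval (F i) z"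
    using f unfolding bounded_analytic_def by metis
  have s: "0 < s a" for a by (rule polydisc_pos[OF x])
  have C: "0 \<le> C" using F(1) by (rule coeff_bounded_nonneg)
  define P where "P \<alpha> = (\<chi> i. ps_eval (hasse \<alpha> (F i)) (vec_nth x))" for \<alpha>
  have "converges_oball P \<rho>"
    unfolding converges_oball_def converges_cball_def
  proof (intro allI impI, elim conjE)
    fix \<rho>' assume \<rho>': "0 < \<rho>'" "\<rho>' < \<rho>"
    have sm: "(\<lambda>\<alpha>. C * mpow (\<lambda>_ :: 'v. \<rho>' / \<rho>) \<alpha>) summable_on UNIV"
      using \<rho>' by (intro summable_on_cmult_right summable_on_mpow) auto
    have le: "supnorm (P \<alpha>) * \<rho>' ^ degree_of \<alpha> \<le> C * mpow (\<lambda>_. \<rho>' / \<rho>) \<alpha>" for \<alpha>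
    proof -
      have "supnorm (P \<alpha>) \<le> C / mpow s \<alpha>"
        unfolding supnorm_le_iff P_def
        using absv_ps_eval_le[OF coeff_bounded_hasse[OF F(1) s] x] by simp
      also have "\<dots> \<le> C / mpow (\<lambda>_. \<rho>) \<alpha>"
        using C \<rho> s by (intro divide_left_mono mpow_mono mult_pos_pos mpow_pos) (auto simp: less_imp_le)
      finally have "supnorm (P \<alpha>) * \<rho>' ^ degree_of \<alpha> \<le> C / mpow (\<lambda>_. \<rho>) \<alpha> * \<rho>' ^ degree_of \<alpha>"
        using \<rho>' by (intro mult_right_mono) auto
      then show ?thesis by (simp add: mpow_const power_divide)
    qed
    show "(\<lambda>\<alpha>. supnorm (P \<alpha>) * \<rho>' ^ degree_of \<alpha>) summable_on UNIV"
      by (rule summable_on_comparison_test[OF sm le]) (use \<rho>' in \<open>simp add: supnorm_nonneg\<close>)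
  qed
  moreover have "f (x + y) = pseries_eval P y" if "y \<in> oball 0 \<rho>" for y
  proof (rule pseries_eval_eqI[symmetric])
    fix i
    have y: "vec_nth y \<in> polydisc s"
      using that \<rho>(2) by (auto simp: in_oball_0_iff polydisc_def intro: less_le_trans)
    have "x + y = vec_lambda (\<lambda>a. x $ a + y $ a)" by (simp add: vec_eq_iff)
    then have "f (x + y) $ i = ps_eval (F i) (\<lambda>a. x $ a + y $ a)"
      using F(2)[OF polydisc_add[OF x y]] by simp
    then show "((\<lambda>\<alpha>. P \<alpha> $ i * mpow (vec_nth y) \<alpha>) has_sum f (x + y) $ i) UNIV"
      unfolding P_def using taylor_has_sum[OF F(1) x y, of i] by simp
  qed
  ultimately show ?thesis by blast
qed

section \<open>The equation \<open>h = w + G(h) u\<close>\<close>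

text \<open>With \<open>R \<le> r\<^sub>i\<close> and \<open>M\<^sub>i \<le> M\<close> for all rows \<open>i\<close>, the entries of \<open>G\<close> share the bound \<open>M\<close> for the Gauss
  norm on the ball of radius \<open>R\<close>.\<close>

locale bounded_system =
  fixes G :: "'n::finite \<Rightarrow> ('k::complete_ultrametric_field, 'n, 'l::finite) pseries"
    and R M :: real
  assumes R_pos: "0 < R" and M_pos: "0 < M"
    and coeff_le: "\<And>i j. coeff_bounded (\<lambda>_. R) M (\<lambda>\<alpha>. G i \<alpha> $ j)"
begin

abbreviation "ball_R \<equiv> polydisc (\<lambda>_. R) :: ('n \<Rightarrow> 'k) set"

definition taylor_coeff :: "'k ^ 'n \<Rightarrow> 'n \<Rightarrow> 'l \<Rightarrow> ('n \<Rightarrow> nat) \<Rightarrow> 'k" where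
  "taylor_coeff w i j \<alpha> = ps_eval (hasse \<alpha> (\<lambda>\<alpha>. G i \<alpha> $ j)) (vec_nth w)"

lemma series_matrix_nth:
  assumes "vec_nth w \<in> ball_R"
  shows "series_matrix G w $ i $ j = ps_eval (\<lambda>\<alpha>. G i \<alpha> $ j) (vec_nth w)"
proof -
  have "pseries_eval (G i) w = (\<chi> j. ps_eval (\<lambda>\<alpha>. G i \<alpha> $ j) (vec_nth w))"
    using ps_eval_has_sum[OF coeff_le assms] by (intro pseries_eval_eqI) simp
  then show ?thesis by (simp add: series_matrix_def)
qed

lemma series_matrix_taylor:
  assumes w: "vec_nth w \<in> ball_R" and v: "vec_nth v \<in> ball_R"
  shows "((\<lambda>\<alpha>. taylor_coeff w i j \<alpha> * mpow (vec_nth v) \<alpha>) has_sum series_matrix G (w + v) $ i $ j) UNIV"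
proof -
  have wv: "vec_nth (w + v) = (\<lambda>i. w $ i + v $ i)" by (simp add: fun_eq_iff)
  then have "vec_nth (w + v) \<in> ball_R" using polydisc_add[OF w v] by simp
  from series_matrix_nth[OF this] show ?thesis
    unfolding taylor_coeff_def using taylor_has_sum[OF coeff_le w v, of i j] by (simp only: wv)
qed

lemma iterated_partial_deriv_series_matrix:
  assumes w: "vec_nth w \<in> ball_R"
  shows "foldr partial_deriv ls (\<lambda>x. series_matrix G x $ i $ j) w =
    of_nat (factorial_index (count_list ls)) * taylor_coeff w i j (count_list ls)"
  unfolding taylor_coeff_def by (rule iterated_partial_deriv[OF coeff_le series_matrix_nth w])

text \<open>\<open>G\<close> is Lipschitz with constant \<open>M / R\<close>: each term of positive degree \<open>n\<close> of its Taylor series is bounded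
  by \<open>M (d / R)\<^sup>n\<close>.\<close>

lemma series_matrix_diff_le:
  assumes x: "vec_nth x \<in> ball_R" and y: "vec_nth y \<in> ball_R" and d: "\<And>i. absv (y $ i - x $ i) \<le> d" "d < R"
  shows "absv (series_matrix G y $ i $ j - series_matrix G x $ i $ j) \<le> M * (d / R)"
proof -
  let ?v = "\<lambda>i. y $ i - x $ i"
  have d0: "0 \<le> d" using d(1) order_trans[OF absv_nonneg] by blast
  have v: "?v \<in> ball_R" using d by (auto simp: polydisc_def intro: le_less_trans)
  have ratio: "mpow (radius_ratio (\<lambda>_. R) ?v) \<alpha> \<le> d / R" if "\<alpha> \<noteq> 0" for \<alpha>
  proof -
    have "degree_of \<alpha> \<noteq> 0" using that by (auto simp: degree_of_def fun_eq_iff)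
    have "mpow (radius_ratio (\<lambda>_. R) ?v) \<alpha> \<le> mpow (\<lambda>_. d / R) \<alpha>"
      using d R_pos by (intro mpow_mono) (auto simp: radius_ratio_def divide_right_mono)
    also have "\<dots> \<le> (d / R) ^ 1"
      unfolding mpow_const using \<open>degree_of \<alpha> \<noteq> 0\<close> d0 d(2) by (intro power_decreasing) auto
    finally show ?thesis by simp
  qed
  have "absv (ps_eval (\<lambda>\<alpha>. G i \<alpha> $ j) (\<lambda>i. x $ i + ?v i) -
      (\<Sum>\<alpha>\<in>{0}. ps_eval (hasse \<alpha> (\<lambda>\<alpha>. G i \<alpha> $ j)) (vec_nth x) * mpow ?v \<alpha>)) \<le> M * (d / R)"
    by (rule taylor_remainder_le[OF coeff_le x v])
       (use mult_left_mono[OF ratio, of _ M] M_pos R_pos d0 in auto)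
  then show ?thesis by (simp add: series_matrix_nth[OF x] series_matrix_nth[OF y])
qed

text \<open>Two solutions at distance \<open>d\<close> satisfy \<open>d \<le> (\<parallel>u\<parallel> M / R) d\<close>.\<close>

lemma solution_unique:
  assumes u: "supnorm u < R / M" and x: "vec_nth x \<in> ball_R" and y: "vec_nth y \<in> ball_R"
    and eq: "x = w + series_matrix G x *v u" "y = w + series_matrix G y *v u"
  shows "x = y"
proof -
  define d where "d = supnorm (y - x)"
  have d0: "0 \<le> d" by (simp add: d_def supnorm_nonneg)
  have d: "absv (y $ i - x $ i) \<le> d" for i
    using absv_nth_le_supnorm[of "y - x" i] by (simp add: d_def)
  have "d < R"
    using x y unfolding d_def supnorm_less_iff
    by (auto simp: polydisc_def intro: le_less_trans[OF absv_diff_le])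
  have "absv (y $ i - x $ i) \<le> M * (d / R) * supnorm u" for i
  proof -
    have "y $ i - x $ i = (\<Sum>j\<in>UNIV. (series_matrix G y $ i $ j - series_matrix G x $ i $ j) * u $ j)"
      by (subst (1) eq(1), subst (1) eq(2))
         (simp add: matrix_vector_mult_def sum_subtractf left_diff_distrib)
    also have "absv \<dots> \<le> M * (d / R) * supnorm u"
    proof (rule absv_sum_le)
      show "absv ((series_matrix G y $ i $ j - series_matrix G x $ i $ j) * u $ j) \<le> M * (d / R) * supnorm u" for j
        unfolding absv_mult using M_pos R_pos d0
        by (intro mult_mono series_matrix_diff_le[OF x y d \<open>d < R\<close>] absv_nth_le_supnorm) auto
    qed (use M_pos R_pos d0 supnorm_nonneg[of u] in auto)
    finally show ?thesis .
  qed
  then have "d \<le> (M * supnorm u / R) * d"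
    unfolding d_def supnorm_le_iff by (simp add: mult_ac)
  moreover have "M * supnorm u / R < 1"
    using u M_pos R_pos by (simp add: field_simps)
  ultimately have "d = 0"
    using d0 mult_strict_right_mono[of "M * supnorm u / R" 1 d] by (cases "d = 0") auto
  then have "absv (y $ i - x $ i) = 0" for i
    using d[of i] absv_nonneg[of "y $ i - x $ i"] by linarith
  then show ?thesis by (simp add: vec_eq_iff)
qed

end

text \<open>Geometric decay requires radii strictly inside those of the theorem. Every point of the domain
  lies in such a smaller polydisc.\<close>

locale bounded_system_polydisc = bounded_system G R M
  for G :: "'n::finite \<Rightarrow> ('k::complete_ultrametric_field, 'n, 'l::finite) pseries" and R M +
  fixes \<sigma> \<tau> :: real
  assumes \<sigma>: "0 < \<sigma>" "\<sigma> < R / M" and \<tau>: "0 < \<tau>" "\<tau> < R"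
begin

definition q :: real where "q = \<sigma> * M / R"

lemma q: "0 < q" "q < 1"
  using \<sigma> R_pos M_pos by (simp_all add: q_def field_simps)

definition radii :: "'l + 'n \<Rightarrow> real" where
  "radii = case_sum (\<lambda>_. \<sigma>) (\<lambda>_. \<tau>)"

lemma radii_pos: "0 < radii a"
  using \<sigma> \<tau> by (simp add: radii_def split: sum.split)

lemma in_polydisc_radii_iff:
  "vec_nth z \<in> polydisc radii \<longleftrightarrow>
     (\<forall>j. absv (left_part z $ j) < \<sigma>) \<and> (\<forall>i. absv (right_part z $ i) < \<tau>)"
proof -
  have "(\<forall>a. P a) \<longleftrightarrow> (\<forall>j. P (Inl j)) \<and> (\<forall>i. P (Inr i))" for P :: "'l + 'n \<Rightarrow> bool"
    by (metis sum.exhaust)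
  then show ?thesis by (simp add: polydisc_def radii_def left_part_def right_part_def)
qed

lemma right_part_in_ball_R:
  assumes "vec_nth z \<in> polydisc radii"
  shows "vec_nth (right_part z) \<in> ball_R"
proof -
  have "absv (right_part z $ i) < \<tau>" for i
    using assms by (simp only: in_polydisc_radii_iff)
  then show ?thesis using \<tau> by (auto simp: polydisc_def intro: less_trans)
qed

abbreviation "T z \<equiv> tree_term (series_matrix G) (left_part z) (right_part z)"

abbreviation "T_fps z \<equiv> tree_fps (series_matrix G) (left_part z) (right_part z)"

lemma tree_term_taylor:
  assumes "vec_nth z \<in> polydisc radii"
  shows "T z (Suc m) $ i =
    (\<Sum>j\<in>UNIV. (\<Sum>\<alpha> | degree_of \<alpha> \<le> m. taylor_coeff (right_part z) i j \<alpha> *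
        fps_nth (mpow (T_fps z) \<alpha>) (m - degree_of \<alpha>)) * left_part z $ j)"
  by (rule tree_term_recursion) (rule iterated_partial_deriv_series_matrix[OF right_part_in_ball_R[OF assms]])

lemma bounded_analytic_taylor_coeff:
  "bounded_analytic radii (M / R ^ degree_of \<alpha>) (\<lambda>z. taylor_coeff (right_part (vec_lambda z)) i j \<alpha>)"
  unfolding taylor_coeff_def mpow_const[symmetric]
proof (rule bounded_analytic_compose[OF radii_pos coeff_bounded_hasse[OF coeff_le]])
  show "bounded_analytic radii \<tau> (\<lambda>z. right_part (vec_lambda z) $ i)" for i
    using bounded_analytic_coordinate[of radii "Inr i"] \<tau> by (simp add: radii_def right_part_def)
qed (use \<tau> R_pos in auto)

text \<open>In the recursion the factors of a summand contribute \<open>M / R\<^bsup>|\<alpha>|\<^esup>\<close>, \<open>(R q)\<^bsup>|\<alpha>|\<^esup> q\<^bsup>m - |\<alpha>|\<^esup>\<close>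
  and \<open>\<sigma>\<close>; their product is \<open>\<sigma> M q\<^sup>m = R q\<^bsup>m + 1\<^esup>\<close>, independently of \<open>\<alpha>\<close>.\<close>

lemma bounded_analytic_tree_term:
  "bounded_analytic radii (R * q ^ Suc m) (\<lambda>z. T (vec_lambda z) (Suc m) $ i)"
proof (induction m arbitrary: i rule: less_induct)
  case (less m)
  have fps: "bounded_analytic radii ((R * q) ^ degree_of \<alpha> * q ^ (m - degree_of \<alpha>))
      (\<lambda>z. fps_nth (mpow (T_fps (vec_lambda z)) \<alpha>) (m - degree_of \<alpha>))"
    if "degree_of \<alpha> \<le> m" for \<alpha>
    \<comment> \<open>For \<open>\<alpha> = 0\<close> the coefficient of index \<open>m\<close> is involved, which belongs to trees of the size
      under consideration, but then the product is empty.\<close>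
  proof (cases "degree_of \<alpha> = 0")
    case True
    then have "\<alpha> = 0" by (auto simp: degree_of_def fun_eq_iff)
    then show ?thesis using True q by (auto intro!: bounded_analytic_const)
  next
    case False
    have "bounded_analytic radii ((R * q) * q ^ k) (\<lambda>z. fps_nth (T_fps (vec_lambda z) l) k)"
      if "k \<le> m - degree_of \<alpha>" for k l
    proof -
      have "k < m" using that False \<open>degree_of \<alpha> \<le> m\<close> by linarith
      then show ?thesis using less.IH[of k l] by (simp add: tree_fps_def mult_ac)
    qed
    then show ?thesis
      using q by (intro bounded_analytic_fps_mpow[where K = "m - degree_of \<alpha>"] radii_pos) auto
  qed
  have summand: "bounded_analytic radii (R * q ^ Suc m) (\<lambda>z. taylor_coeff (right_part (vec_lambda z)) i j \<alpha> *
      fps_nth (mpow (T_fps (vec_lambda z)) \<alpha>) (m - degree_of \<alpha>) * left_part (vec_lambda z) $ j)"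
    if "degree_of \<alpha> \<le> m" for \<alpha> j
  proof -
    have u: "bounded_analytic radii \<sigma> (\<lambda>z. left_part (vec_lambda z) $ j)"
      using bounded_analytic_coordinate[of radii "Inl j"] \<sigma> by (simp add: radii_def left_part_def)
    have "q ^ m = q ^ degree_of \<alpha> * q ^ (m - degree_of \<alpha>)"
      using that by (simp flip: power_add)
    then have "R * q ^ Suc m = M / R ^ degree_of \<alpha> * ((R * q) ^ degree_of \<alpha> * q ^ (m - degree_of \<alpha>)) * \<sigma>"
      using R_pos by (simp add: power_mult_distrib) (simp add: q_def)
    then show ?thesis
      by (simp only:) (intro bounded_analytic_mult radii_pos bounded_analytic_taylor_coeff fps[OF that] u)
  qed
  have "bounded_analytic radii (R * q ^ Suc m) (\<lambda>z. \<Sum>j\<in>UNIV. \<Sum>\<alpha> | degree_of \<alpha> \<le> m.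
      taylor_coeff (right_part (vec_lambda z)) i j \<alpha> *
      fps_nth (mpow (T_fps (vec_lambda z)) \<alpha>) (m - degree_of \<alpha>) * left_part (vec_lambda z) $ j)"
    using R_pos q by (intro bounded_analytic_sum radii_pos summand mult_nonneg_nonneg zero_le_power) auto
  then show ?case
    by (rule bounded_analytic_cong) (simp add: tree_term_taylor vec_lambda_inverse sum_distrib_right)
qed

lemma absv_tree_term_le:
  assumes "vec_nth z \<in> polydisc radii"
  shows "absv (T z (Suc m) $ i) \<le> R * q * q ^ m"
  using bounded_analytic_le[OF bounded_analytic_tree_term assms, of m i] by (simp add: vec_nth_inverse mult_ac)

definition correction :: "'k ^ ('l + 'n) \<Rightarrow> 'k ^ 'n" where
  "correction z = (\<chi> i. \<Sum>\<^sub>\<infinity>m. T z (Suc m) $ i)"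

lemma correction_has_sum:
  assumes "vec_nth z \<in> polydisc radii"
  shows "((\<lambda>m. T z (Suc m) $ i) has_sum correction z $ i) UNIV"
proof -
  have "(\<lambda>m. T z (Suc m) $ i) summable_on UNIV"
    by (rule summable_on_dominated[OF summable_on_cmult_right[OF summable_geometric_nat]])
       (use q absv_tree_term_le[OF assms] in auto)
  then show ?thesis by (simp add: correction_def)
qed

lemma tree_sum_eq_correction:
  assumes "vec_nth z \<in> polydisc radii"
  shows "summable (\<lambda>m. T z (Suc m))"
    and "tree_sum (series_matrix G) (left_part z) (right_part z) = right_part z + correction z"
proof -
  have "(\<lambda>m. T z (Suc m)) sums correction z"
    by (intro has_sum_imp_sums has_sum_vecI correction_has_sum assms)
  then show "summable (\<lambda>m. T z (Suc m))"
    "tree_sum (series_matrix G) (left_part z) (right_part z) = right_part z + correction z"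
    by (auto simp: tree_sum_def sums_iff)
qed

lemma correction_in_ball_R:
  assumes "vec_nth z \<in> polydisc radii"
  shows "vec_nth (correction z) \<in> ball_R"
proof -
  have "absv (correction z $ i) \<le> R * q" for i
  proof (rule absv_has_sum_le[OF correction_has_sum[OF assms]])
    fix m
    have "R * q * q ^ m \<le> R * q * 1" using R_pos q by (intro mult_left_mono power_le_one) auto
    then show "absv (T z (Suc m) $ i) \<le> R * q" using absv_tree_term_le[OF assms, of m i] by simp
  qed (use R_pos q in auto)
  moreover have "R * q < R" using R_pos q by simp
  ultimately show ?thesis by (auto simp: polydisc_def intro: le_less_trans)
qed

text \<open>Summing the recursion over \<open>m\<close> is summing the family \<open>c\<^sub>\<alpha> [X\<^sup>k] g\<^sup>\<alpha>\<close>, with \<open>g\<close> the shifted generating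
  function, over the fibres of \<open>m = k + |\<alpha>|\<close>. Summing it over \<open>k\<close> first gives
  \<open>c\<^sub>\<alpha> v\<^sup>\<alpha>\<close>, the terms of the Taylor series of \<open>G(w + v)\<close>. The family is dominated by
  \<open>M q\<^bsup>|\<alpha>|\<^esup> q\<^sup>k\<close>.\<close>

lemma correction_fixed_point:
  assumes z: "vec_nth z \<in> polydisc radii"
  shows "correction z = series_matrix G (right_part z + correction z) *v left_part z"
proof -
  let ?w = "right_part z" and ?v = "correction z"
  have w: "vec_nth ?w \<in> ball_R" and v: "vec_nth ?v \<in> ball_R"
    using right_part_in_ball_R[OF z] correction_in_ball_R[OF z] .
  have val: "fps_value q ((R * q) ^ degree_of \<alpha>) (mpow (T_fps z) \<alpha>) (mpow (vec_nth ?v) \<alpha>)" for \<alpha>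
  proof (rule fps_value_mpow)
    have "fps_nth (T_fps z l) = (\<lambda>m. T z (Suc m) $ l)" for l
      by (simp add: fun_eq_iff tree_fps_def)
    then show "fps_value q (R * q) (T_fps z l) (?v $ l)" for l
      using absv_tree_term_le[OF z] correction_has_sum[OF z, of l] by (simp add: fps_value_def)
  qed (use q in auto)
  have "?v $ i = (\<Sum>j\<in>UNIV. series_matrix G (?w + ?v) $ i $ j * left_part z $ j)" for i
  proof -
    have "((\<lambda>m. \<Sum>\<alpha> | degree_of \<alpha> \<le> m. taylor_coeff ?w i j \<alpha> *
        fps_nth (mpow (T_fps z) \<alpha>) (m - degree_of \<alpha>)) has_sum series_matrix G (?w + ?v) $ i $ j) UNIV" for j
    proof -
      define f where "f \<alpha> k = taylor_coeff ?w i j \<alpha> * fps_nth (mpow (T_fps z) \<alpha>) k" for \<alpha> k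
      have le: "absv (f \<alpha> k) \<le> (M * mpow (\<lambda>_. q) \<alpha>) * q ^ k" for \<alpha> k
      proof -
        have "absv (f \<alpha> k) \<le> (M / R ^ degree_of \<alpha>) * ((R * q) ^ degree_of \<alpha> * q ^ k)"
          unfolding f_def absv_mult
        proof (intro mult_mono)
          show "absv (taylor_coeff ?w i j \<alpha>) \<le> M / R ^ degree_of \<alpha>"
            using bounded_analytic_le[OF bounded_analytic_taylor_coeff z] by (simp add: vec_nth_inverse)
        qed (use val[of \<alpha>] M_pos R_pos in \<open>auto simp: fps_value_def\<close>)
        also have "\<dots> = (M * mpow (\<lambda>_. q) \<alpha>) * q ^ k"
          using R_pos by (simp add: power_mult_distrib mpow_const)
        finally show ?thesis .
      qed
      have row: "(\<Sum>\<^sub>\<infinity>k. f \<alpha> k) = taylor_coeff ?w i j \<alpha> * mpow (vec_nth ?v) \<alpha>" for \<alpha>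
        unfolding f_def using val[of \<alpha>] by (intro infsumI has_sum_cmult_right) (simp add: fps_value_def)
      have "bij_betw (\<lambda>(m, \<alpha>). (\<alpha>, m - degree_of \<alpha>))
          (SIGMA m:UNIV. {\<alpha> :: 'n \<Rightarrow> nat. degree_of \<alpha> \<le> m}) UNIV"
        by (rule bij_betw_byWitness[where f' = "\<lambda>(\<alpha>, k). (k + degree_of \<alpha>, \<alpha>)"]) auto
      then have "((\<lambda>m. \<Sum>\<alpha> | degree_of \<alpha> \<le> m. f \<alpha> (m - degree_of \<alpha>)) has_sum (\<Sum>\<^sub>\<infinity>\<alpha>. \<Sum>\<^sub>\<infinity>k. f \<alpha> k)) UNIV"
        using q M_pos
        by (intro has_sum_fibres[OF summable_on_cmult_right[OF summable_on_mpow] summable_geometric_nat le])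
           (auto simp: finite_degree_le mpow_nonneg)
      also have "(\<Sum>\<^sub>\<infinity>\<alpha>. \<Sum>\<^sub>\<infinity>k. f \<alpha> k) = series_matrix G (?w + ?v) $ i $ j"
        unfolding row by (rule infsumI[OF series_matrix_taylor[OF w v]])
      finally show ?thesis by (simp add: f_def)
    qed
    then have "((\<lambda>m. T z (Suc m) $ i) has_sum
        (\<Sum>j\<in>UNIV. series_matrix G (?w + ?v) $ i $ j * left_part z $ j)) UNIV"
      unfolding tree_term_taylor[OF z] by (intro has_sum_sum has_sum_cmult_left)
    then show ?thesis using correction_has_sum[OF z, of i] has_sum_unique by blast
  qed
  then show ?thesis by (simp add: vec_eq_iff matrix_vector_mult_def)
qed

lemma tree_sum_solves:
  assumes z: "vec_nth z \<in> polydisc radii"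
  defines "h \<equiv> tree_sum (series_matrix G) (left_part z) (right_part z)"
  shows "vec_nth h \<in> ball_R" and "h = right_part z + series_matrix G h *v left_part z"
proof -
  have h: "h = right_part z + correction z" by (simp add: h_def tree_sum_eq_correction[OF z])
  then have "vec_nth h = (\<lambda>i. right_part z $ i + correction z $ i)" by (simp add: fun_eq_iff)
  then show "vec_nth h \<in> ball_R"
    using polydisc_add[OF right_part_in_ball_R[OF z] correction_in_ball_R[OF z]] by simp
  show "h = right_part z + series_matrix G h *v left_part z"
    using correction_fixed_point[OF z] h by simp
qed

lemma bounded_analytic_tree_sum:
  "bounded_analytic radii R
     (\<lambda>z. tree_sum (series_matrix G) (left_part (vec_lambda z)) (right_part (vec_lambda z)) $ i)"
proof -
  have w: "bounded_analytic radii R (\<lambda>z. right_part (vec_lambda z) $ i)"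
    using bounded_analytic_mono[OF bounded_analytic_coordinate[of radii "Inr i"], of R] \<tau>
    by (simp add: radii_def right_part_def)
  have "bounded_analytic radii R (\<lambda>z. \<Sum>\<^sub>\<infinity>m. T (vec_lambda z) (Suc m) $ i)"
  proof (rule bounded_analytic_infsum[OF radii_pos bounded_analytic_tree_term])
    show "(\<lambda>m. R * q ^ Suc m) summable_on UNIV"
      using summable_on_cmult_right[OF summable_geometric_nat[of q], of "R * q"] q by (simp add: mult_ac)
    show "R * q ^ Suc m \<le> R" for m
      using R_pos q power_le_one[of q "Suc m"] mult_left_mono[of "q ^ Suc m" 1 R] by simp
  qed (use R_pos in simp)
  from bounded_analytic_add[OF radii_pos w this] show ?thesis
    by (rule bounded_analytic_cong)
       (simp add: tree_sum_eq_correction vec_lambda_inverse correction_def)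
qed

end

theorem corollary2p5:
  fixes G :: "'n::finite \<Rightarrow> ('k::complete_ultrametric_field, 'n, 'l::finite) pseries"
    and r :: "'n \<Rightarrow> real"
    and R M :: real
  assumes r_pos: "\<And>i. r i > 0"
    and conv: "\<And>i. converges_cball (G i) (r i)"
    and norm_pos: "\<And>i. pseries_norm (G i) (r i) > 0"
    and R: "R = (MIN i. r i)"
    and M: "M = (MAX i. pseries_norm (G i) (r i))"
  shows "(\<forall>u \<in> oball 0 (R / M). \<forall>w \<in> oball 0 R.
            summable (\<lambda>N. tree_term (series_matrix G) u w (Suc N)) \<and>
            tree_sum (series_matrix G) u w \<in> oball 0 R \<and>
            tree_sum (series_matrix G) u w =
              w + series_matrix G (tree_sum (series_matrix G) u w) *v u \<and>
            (\<forall>h \<in> oball 0 R. h = w + series_matrix G h *v u \<longrightarrow>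
               h = tree_sum (series_matrix G) u w)) \<and>
         ultra_analytic_on
           (\<lambda>z :: 'k ^ ('l + 'n). tree_sum (series_matrix G) (left_part z) (right_part z))
           {z. left_part z \<in> oball 0 (R / M) \<and> right_part z \<in> oball 0 R}"
proof -
  have R_pos: "0 < R" unfolding R using r_pos by (subst Min_gr_iff) auto
  have R_le: "R \<le> r i" for i unfolding R by (rule Min_le) auto
  have M_ge: "pseries_norm (G i) (r i) \<le> M" for i unfolding M by (rule Max_ge) auto
  have M_pos: "0 < M" using norm_pos M_ge less_le_trans by blast
  have le: "coeff_bounded (\<lambda>_. R) M (\<lambda>\<alpha>. G i \<alpha> $ j)" for i j
    unfolding coeff_bounded_def mpow_const
  proof
    fix \<alpha>
    let ?g = "\<lambda>\<alpha>. supnorm (G i \<alpha>) * r i ^ degree_of \<alpha>"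
    \<comment> \<open>The supremum that defines the norm is finite because the series converges absolutely.\<close>
    have g0: "0 \<le> ?g \<alpha>" for \<alpha> using r_pos[of i] by (simp add: supnorm_nonneg)
    have "bdd_above (range ?g)"
    proof (rule bdd_aboveI2)
      fix \<alpha>
      show "?g \<alpha> \<le> infsum ?g UNIV"
        using finite_sum_le_infsum[of ?g UNIV "{\<alpha>}"] conv[of i] g0 by (simp add: converges_cball_def)
    qed
    then have "?g \<alpha> \<le> pseries_norm (G i) (r i)"
      unfolding pseries_norm_def by (rule cSUP_upper[OF UNIV_I])
    moreover have "absv (G i \<alpha> $ j) * R ^ degree_of \<alpha> \<le> ?g \<alpha>"
      using R_pos R_le[of i] by (intro mult_mono absv_nth_le_supnorm power_mono supnorm_nonneg) auto
    ultimately show "absv (G i \<alpha> $ j) * R ^ degree_of \<alpha> \<le> M" using M_ge[of i] by linarith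
  qed
  interpret bounded_system G R M
    by standard (rule R_pos M_pos le)+
  have polydisc: "\<exists>\<sigma> \<tau>. bounded_system_polydisc G R M \<sigma> \<tau> \<and>
      vec_nth z \<in> polydisc (bounded_system_polydisc.radii \<sigma> \<tau>)"
    if "left_part z \<in> oball 0 (R / M)" "right_part z \<in> oball 0 R" for z :: "'k ^ ('l + 'n)"
  proof -
    have *: "supnorm (left_part z) < R / M" "supnorm (right_part z) < R"
      using that by (auto simp: in_oball_0_iff polydisc_def supnorm_less_iff)
    obtain \<sigma> \<tau> where \<sigma>: "supnorm (left_part z) < \<sigma>" "\<sigma> < R / M"
      and \<tau>: "supnorm (right_part z) < \<tau>" "\<tau> < R"
      using dense[OF *(1)] dense[OF *(2)] by blast
    interpret P: bounded_system_polydisc G R M \<sigma> \<tau>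
      by standard (use \<sigma> \<tau> supnorm_nonneg[of "left_part z"] supnorm_nonneg[of "right_part z"] in linarith)+
    have "vec_nth z \<in> polydisc P.radii"
      using \<sigma> \<tau> unfolding P.in_polydisc_radii_iff supnorm_less_iff by blast
    then show ?thesis using P.bounded_system_polydisc_axioms by blast
  qed
  show ?thesis
  proof (intro conjI ballI allI impI)
    fix u :: "'k ^ 'l" and w :: "'k ^ 'n"
    assume u: "u \<in> oball 0 (R / M)" and w: "w \<in> oball 0 R"
    define z :: "'k ^ ('l + 'n)" where "z = (\<chi> a. case a of Inl j \<Rightarrow> u $ j | Inr i \<Rightarrow> w $ i)"
    have parts: "left_part z = u" "right_part z = w"
      by (simp_all add: z_def left_part_def right_part_def)
    obtain \<sigma> \<tau> where "bounded_system_polydisc G R M \<sigma> \<tau>"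
      and z: "vec_nth z \<in> polydisc (bounded_system_polydisc.radii \<sigma> \<tau>)"
      using polydisc[of z] u w parts by auto
    then interpret P: bounded_system_polydisc G R M \<sigma> \<tau> by simp
    show "summable (\<lambda>N. tree_term (series_matrix G) u w (Suc N))"
      using P.tree_sum_eq_correction(1)[OF z] parts by simp
    show *: "tree_sum (series_matrix G) u w \<in> oball 0 R"
      using P.tree_sum_solves(1)[OF z] parts by (simp add: in_oball_0_iff)
    show **: "tree_sum (series_matrix G) u w = w + series_matrix G (tree_sum (series_matrix G) u w) *v u"
      using P.tree_sum_solves(2)[OF z] parts by simp
    fix h assume h: "h \<in> oball 0 R" "h = w + series_matrix G h *v u"
    have u': "supnorm u < R / M"
      using u by (auto simp: in_oball_0_iff polydisc_def supnorm_less_iff)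
    show "h = tree_sum (series_matrix G) u w"
      by (rule solution_unique[OF u' _ _ h(2) **]) (use h(1) * in \<open>simp_all only: in_oball_0_iff\<close>)
  next
    let ?U = "{z :: 'k ^ ('l + 'n). left_part z \<in> oball 0 (R / M) \<and> right_part z \<in> oball 0 R}"
    show "ultra_analytic_on (\<lambda>z. tree_sum (series_matrix G) (left_part z) (right_part z)) ?U"
      unfolding ultra_analytic_on_def
    proof (intro ballI)
      fix x assume "x \<in> ?U"
      then obtain \<sigma> \<tau> where "bounded_system_polydisc G R M \<sigma> \<tau>"
        and x: "vec_nth x \<in> polydisc (bounded_system_polydisc.radii \<sigma> \<tau>)"
        using polydisc[of x] by auto
      then interpret P: bounded_system_polydisc G R M \<sigma> \<tau> by simp
      let ?\<rho> = "min \<sigma> \<tau>"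
      have \<rho>: "0 < ?\<rho>" "?\<rho> \<le> P.radii a" for a
        using P.\<sigma> P.\<tau> by (auto simp: P.radii_def split: sum.split)
      have "y \<in> ?U" if "y \<in> oball x ?\<rho>" for y
      proof -
        have "absv (y $ a) < P.radii a" for a
        proof -
          have "absv (x $ a - y $ a) < ?\<rho>"
            using that by (simp add: oball_def supnorm_less_iff)
          moreover have "absv (x $ a) < P.radii a" using x by (simp add: polydisc_def)
          ultimately have "absv (x $ a - (x $ a - y $ a)) < P.radii a"
            using absv_diff_le[of "x $ a" "x $ a - y $ a"] \<rho>(2)[of a] by linarith
          then show ?thesis by simp
        qed
        then have "vec_nth y \<in> polydisc P.radii" by (simp add: polydisc_def)
        then show ?thesis
          using P.\<sigma> P.\<tau> unfolding P.in_polydisc_radii_iff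
          by (auto simp: in_oball_0_iff polydisc_def intro: less_trans)
      qed
      then show "\<exists>\<rho>>0. oball x \<rho> \<subseteq> ?U \<and> (\<exists>F. converges_oball F \<rho> \<and>
          (\<forall>y\<in>oball 0 \<rho>. tree_sum (series_matrix G) (left_part (x + y)) (right_part (x + y)) = pseries_eval F y))"
        using bounded_analytic_expansion[OF P.bounded_analytic_tree_sum x \<rho>] \<rho>(1)
        by (intro exI[of _ ?\<rho>] conjI) auto
    qed
  qed
qed

end
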